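(* For $1\le i\le n$, in $K_T(G/B)$, $$[\mathcal{O}_{X_{w_0s_i}}]=1-e^{w_0\omega_i}[X^{-\omega_i}],$$ where $1=[\mathcal{O}_{X_{w_0}}]$ is the identity of the ring $K_T(G/B)$ and $[X^{\lambda}]=X^{\lambda}[\mathcal{O}_{X_{w_0}}]$ for $\lambda\in P$.
   Context: Let $\mathfrak h^*$ be a real vector space of dimension $n$ with a reduced irreducible (finite, crystallographic) root system of rank $n$, with Weyl group $W$, a fixed set of positive roots, simple roots $\alpha_1,\dots,\alpha_n$, simple reflections $s_1,\dots,s_n$, fundamental weights $\omega_1,\dots,\omega_n$, weight lattice $P=\sum_i\mathbb{Z}\omega_i$. Let $\le$ be the Bruhat order on $W$, $w_0$ the longest element of $W$, and $m_{ij}$ the order of $s_is_j$. The affine nil-Hecke algebra $\tilde H$ is the $\mathbb{Z}$-algebra generated by $T_1,\dots,T_n$ and $X^\lambda$ ($\lambda\in P$) with relations $T_i^2=T_i$; $T_iT_jT_i\cdots=T_jT_iT_j\cdots$ ($m_{ij}$ factors on each side); $X^\lambda X^\mu=X^{\lambda+\mu}$ (with $X^0=1$); and $X^\lambda T_i=T_iX^{s_i\lambda}+\dfrac{X^\lambda-X^{s_i\lambda}}{1-X^{-\alpha_i}}$. For a reduced word $w=s_{i_1}\cdots s_{i_p}$ put $T_w=T_{i_1}\cdots T_{i_p}$. Let $R=\mathbb{Z}\text{-span}\{e^\lambda\mid\lambda\in P\}$ with $e^\lambda e^\mu=e^{\lambda+\mu}$, $\tilde H_R=R\otimes_{\mathbb{Z}}\tilde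 H$, $R[X]=R\text{-span}\{X^\lambda\mid\lambda\in P\}$. Define (purely algebraically) $K_T(G/B)$ to be the $\tilde H_R$-module which is free over $R$ with basis $\{[\mathcal{O}_{X_w}]\mid w\in W\}$ and with action determined by $X^\lambda[\mathcal{O}_{X_1}]=e^\lambda[\mathcal{O}_{X_1}]$, and $T_i[\mathcal{O}_{X_w}]=[\mathcal{O}_{X_{ws_i}}]$ if $ws_i>w$, $T_i[\mathcal{O}_{X_w}]=[\mathcal{O}_{X_w}]$ if $ws_i<w$. (Equivalently $K_T(G/B)\cong\tilde H_R\otimes_{R[X]}R_e$, where $R[X]$ acts on $R_e=R$ by $X^\lambda\mapsto e^\lambda$.) Thus $[\mathcal{O}_{X_w}]=T_{w^{-1}}[\mathcal{O}_{X_1}]$. The map $R[X]\to K_T(G/B)$, $f\mapsto f[\mathcal{O}_{X_{w_0}}]$, is surjective and its kernel is an ideal of $R[X]$; this gives $K_T(G/B)$ its ring structure, with identity $[\mathcal{O}_{X_{w_0}}]$. *)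

theory Defs
  imports Complex_Main "HOL-Library.Poly_Mapping" "HOL-Library.FuncSet" "HOL-Algebra.QuotRing" "HOL-Algebra.Module"
begin

section \<open>Root systems and Weyl groups\<close>

text \<open>Root systems in a real vector space without a chosen inner product; the coroot is a linear
  functional.\<close>

definition is_coroot :: "'v::real_vector set \<Rightarrow> 'v \<Rightarrow> ('v \<Rightarrow> real) \<Rightarrow> bool" where
  "is_coroot \<Phi> \<beta> f \<longleftrightarrow>
     linear f \<and> f \<beta> = 2 \<and> (\<forall>\<gamma>\<in>\<Phi>. f \<gamma> \<in> \<int> \<and> \<gamma> - f \<gamma> *\<^sub>R \<beta> \<in> \<Phi>)"

definition root_system :: "'v::real_vector set \<Rightarrow> bool" where
  "root_system \<Phi> \<longleftrightarrow>
     finite \<Phi> \<and> 0 \<notin> \<Phi> \<and> span \<Phi> = UNIV \<and> (\<forall>\<beta>\<in>\<Phi>. \<exists>f. is_coroot \<Phi> \<beta> f)"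

text \<open>Since \<open>\<Phi>\<close> is finite and spans, a root has only one coroot
  (lemma \<open>is_coroot_unique\<close>).\<close>

definition coroot :: "'v::real_vector set \<Rightarrow> 'v \<Rightarrow> 'v \<Rightarrow> real" where
  "coroot \<Phi> \<beta> = (THE f. is_coroot \<Phi> \<beta> f)"

definition root_refl :: "'v::real_vector set \<Rightarrow> 'v \<Rightarrow> 'v \<Rightarrow> 'v" where
  "root_refl \<Phi> \<beta> v = v - coroot \<Phi> \<beta> v *\<^sub>R \<beta>"

definition reduced :: "'v::real_vector set \<Rightarrow> bool" where
  "reduced \<Phi> \<longleftrightarrow> (\<forall>\<beta>\<in>\<Phi>. \<forall>c. c *\<^sub>R \<beta> \<in> \<Phi> \<longrightarrow> c = 1 \<or> c = -1)"

definition irreducible_roots :: "'v::real_vector set \<Rightarrow> bool" where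
  "irreducible_roots \<Phi> \<longleftrightarrow> \<Phi> \<noteq> {} \<and>
     \<not> (\<exists>A B. A \<noteq> {} \<and> B \<noteq> {} \<and> A \<inter> B = {} \<and> A \<union> B = \<Phi> \<and>
            (\<forall>\<beta>\<in>A. \<forall>\<gamma>\<in>B. coroot \<Phi> \<beta> \<gamma> = 0 \<and> coroot \<Phi> \<gamma> \<beta> = 0))"

text \<open>Choosing a positive system is the same as choosing its simple roots: the positive roots are the
  nonnegative integral combinations of the \<open>\<alpha> i\<close> lying in \<open>\<Phi>\<close>. The index type
  \<open>'i\<close> plays the role of \<open>{1, \<dots>, n}\<close>; as the simple roots form a basis,
  the dimension is \<open>CARD('i)\<close>.\<close>

definition simple_roots :: "'v::real_vector set \<Rightarrow> ('i::finite \<Rightarrow> 'v) \<Rightarrow> bool" where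
  "simple_roots \<Phi> \<alpha> \<longleftrightarrow>
     inj \<alpha> \<and> range \<alpha> \<subseteq> \<Phi> \<and> independent (range \<alpha>) \<and> span (range \<alpha>) = UNIV \<and>
     (\<forall>\<beta>\<in>\<Phi>. \<exists>c :: 'i \<Rightarrow> nat. \<beta> = (\<Sum>i\<in>UNIV. real (c i) *\<^sub>R \<alpha> i) \<or>
                              \<beta> = - (\<Sum>i\<in>UNIV. real (c i) *\<^sub>R \<alpha> i))"

definition fundamental_weights ::
    "'v::real_vector set \<Rightarrow> ('i::finite \<Rightarrow> 'v) \<Rightarrow> ('i \<Rightarrow> 'v) \<Rightarrow> bool" where
  "fundamental_weights \<Phi> \<alpha> \<omega> \<longleftrightarrow>
     (\<forall>i j. coroot \<Phi> (\<alpha> j) (\<omega> i) = (if i = j then 1 else 0))"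

definition weight_lattice :: "('i::finite \<Rightarrow> 'v::real_vector) \<Rightarrow> 'v set" where
  "weight_lattice \<omega> = {\<Sum>i\<in>UNIV. of_int (c i) *\<^sub>R \<omega> i | c :: 'i \<Rightarrow> int. True}"

text \<open>Reflections are involutions, so the group they generate is the monoid they generate.\<close>

inductive_set weyl :: "'v::real_vector set \<Rightarrow> ('v \<Rightarrow> 'v) set" for \<Phi> where
  weyl_id: "id \<in> weyl \<Phi>"
| weyl_refl: "\<beta> \<in> \<Phi> \<Longrightarrow> w \<in> weyl \<Phi> \<Longrightarrow> root_refl \<Phi> \<beta> \<circ> w \<in> weyl \<Phi>"

definition simple_word :: "'v::real_vector set \<Rightarrow> ('i \<Rightarrow> 'v) \<Rightarrow> 'i list \<Rightarrow> 'v \<Rightarrow> 'v" where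
  "simple_word \<Phi> \<alpha> is = foldr (\<lambda>i w. root_refl \<Phi> (\<alpha> i) \<circ> w) is id"

definition weyl_length :: "'v::real_vector set \<Rightarrow> ('i \<Rightarrow> 'v) \<Rightarrow> ('v \<Rightarrow> 'v) \<Rightarrow> nat" where
  "weyl_length \<Phi> \<alpha> w = (LEAST k. \<exists>is. length is = k \<and> simple_word \<Phi> \<alpha> is = w)"

definition bruhat_step ::
    "'v::real_vector set \<Rightarrow> ('i \<Rightarrow> 'v) \<Rightarrow> ('v \<Rightarrow> 'v) \<Rightarrow> ('v \<Rightarrow> 'v) \<Rightarrow> bool" where
  "bruhat_step \<Phi> \<alpha> u v \<longleftrightarrow> u \<in> weyl \<Phi> \<and> v \<in> weyl \<Phi> \<and>
     (\<exists>\<beta>\<in>\<Phi>. v = u \<circ> root_refl \<Phi> \<beta>) \<and> weyl_length \<Phi> \<alpha> u < weyl_length \<Phi> \<alpha> v"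

definition bruhat_less ::
    "'v::real_vector set \<Rightarrow> ('i \<Rightarrow> 'v) \<Rightarrow> ('v \<Rightarrow> 'v) \<Rightarrow> ('v \<Rightarrow> 'v) \<Rightarrow> bool" where
  "bruhat_less \<Phi> \<alpha> = (bruhat_step \<Phi> \<alpha>)\<^sup>+\<^sup>+"

definition longest_element ::
    "'v::real_vector set \<Rightarrow> ('i \<Rightarrow> 'v) \<Rightarrow> ('v \<Rightarrow> 'v) \<Rightarrow> bool" where
  "longest_element \<Phi> \<alpha> w0 \<longleftrightarrow>
     w0 \<in> weyl \<Phi> \<and> (\<forall>w\<in>weyl \<Phi>. weyl_length \<Phi> \<alpha> w \<le> weyl_length \<Phi> \<alpha> w0)"

definition coxeter_order :: "'v::real_vector set \<Rightarrow> ('i \<Rightarrow> 'v) \<Rightarrow> 'i \<Rightarrow> 'i \<Rightarrow> nat" where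
  "coxeter_order \<Phi> \<alpha> i j =
     (LEAST m. 0 < m \<and> (root_refl \<Phi> (\<alpha> i) \<circ> root_refl \<Phi> (\<alpha> j)) ^^ m = id)"

lemma is_coroot_unique:
  assumes \<Phi>: "finite \<Phi>" "0 \<notin> \<Phi>" "span \<Phi> = UNIV" and \<beta>: "\<beta> \<in> \<Phi>"
    and f: "is_coroot \<Phi> \<beta> f" and g: "is_coroot \<Phi> \<beta> g"
  shows "f = g"
proof -
  have step: "\<gamma> + (f \<gamma> - g \<gamma>) *\<^sub>R \<beta> \<in> \<Phi>" if "\<gamma> \<in> \<Phi>" for \<gamma>
  proof -
    let ?\<delta> = "\<gamma> - f \<gamma> *\<^sub>R \<beta>"
    have "?\<delta> \<in> \<Phi>" using f that by (simp add: is_coroot_def)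
    hence mem: "?\<delta> - g ?\<delta> *\<^sub>R \<beta> \<in> \<Phi>" using g by (simp add: is_coroot_def)
    have val: "g ?\<delta> = g \<gamma> - 2 * f \<gamma>"
      using g by (simp add: is_coroot_def linear_diff linear_scale)
    have "?\<delta> - g ?\<delta> *\<^sub>R \<beta> = \<gamma> + (f \<gamma> - g \<gamma>) *\<^sub>R \<beta>"
      unfolding val mult_2 scaleR_diff_left scaleR_add_left by (simp add: algebra_simps)
    with mem show ?thesis by (rule back_subst[of "\<lambda>x. x \<in> \<Phi>"])
  qed
  have diff: "f (\<gamma> + c *\<^sub>R \<beta>) - g (\<gamma> + c *\<^sub>R \<beta>) = f \<gamma> - g \<gamma>" for \<gamma> c
    using f g by (simp add: is_coroot_def linear_add linear_scale)
  have iter: "\<gamma> + (real k * (f \<gamma> - g \<gamma>)) *\<^sub>R \<beta> \<in> \<Phi>" if "\<gamma> \<in> \<Phi>" for \<gamma> k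
  proof (induction k)
    case 0 then show ?case using that by simp
  next
    case (Suc k)
    have "\<gamma> + (real k * (f \<gamma> - g \<gamma>)) *\<^sub>R \<beta> + (f \<gamma> - g \<gamma>) *\<^sub>R \<beta> \<in> \<Phi>"
      using step[OF Suc] unfolding diff .
    then show ?case by (simp add: distrib_right scaleR_add_left ac_simps)
  qed
  have eq: "f \<gamma> = g \<gamma>" if "\<gamma> \<in> \<Phi>" for \<gamma>
  proof (rule ccontr)
    assume ne: "f \<gamma> \<noteq> g \<gamma>"
    let ?h = "\<lambda>k. \<gamma> + (real k * (f \<gamma> - g \<gamma>)) *\<^sub>R \<beta>"
    have "\<beta> \<noteq> 0" using \<beta> \<Phi> by auto
    hence "inj ?h" using ne by (auto simp: inj_on_def)
    moreover have "finite (range ?h)"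
      using iter[OF that] \<Phi>(1) by (meson finite_subset image_subsetI)
    ultimately show False using finite_imageD by blast
  qed
  have lin: "linear f" "linear g" using f g by (auto simp: is_coroot_def)
  show ?thesis
  proof
    fix x
    have "x \<in> span \<Phi>" using \<Phi> by simp
    then show "f x = g x" using linear_eq_on[OF lin, of x \<Phi>] eq by blast
  qed
qed

section \<open>The affine nil-Hecke algebra\<close>

text \<open>Words under concatenation form the free monoid, so the type of finitely supported functions
  from words to a ring, with its convolution product, is the free associative algebra.\<close>

instantiation list :: (type) monoid_add
begin

definition zero_list :: "'a list" where "zero_list = []"
definition plus_list :: "'a list \<Rightarrow> 'a list \<Rightarrow> 'a list" where "plus_list = (@)"

instance by standard (simp_all add: zero_list_def plus_list_def)

end

datatype ('i, 'v) generator = gen_T 'i | gen_X 'v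

type_synonym ('i, 'v, 'k) free_alg = "('i, 'v) generator list \<Rightarrow>\<^sub>0 'k"

text \<open>The subring \<open>S\<close> of \<open>'k\<close> is the coefficient ring; only \<open>gen_X \<mu>\<close> with
  \<open>\<mu> \<in> P\<close> are generators.\<close>

definition free_algebra :: "'v set \<Rightarrow> 'k::comm_ring_1 set \<Rightarrow> ('i, 'v, 'k) free_alg ring" where
  "free_algebra P S =
     \<lparr>carrier = {x. \<forall>w\<in>Poly_Mapping.keys x.
                    Poly_Mapping.lookup x w \<in> S \<and> (\<forall>\<mu>. gen_X \<mu> \<in> set w \<longrightarrow> \<mu> \<in> P)},
      monoid.mult = (*), one = 1, zero = 0, add = (+)\<rparr>"

definition wmon :: "('i, 'v) generator list \<Rightarrow> ('i, 'v, 'k::comm_ring_1) free_alg" where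
  "wmon w = Poly_Mapping.single w 1"

text \<open>The linear extension of \<open>e\<^sup>\<mu> \<mapsto> X\<^sup>\<mu>\<close>; here a finitely supported
  function on weights is an element of a group algebra with basis \<open>e\<^sup>\<mu>\<close>.\<close>

definition X_sum :: "('v \<Rightarrow>\<^sub>0 'k) \<Rightarrow> ('i, 'v, 'k::comm_ring_1) free_alg" where
  "X_sum f = (\<Sum>\<mu>\<in>Poly_Mapping.keys f. Poly_Mapping.single [gen_X \<mu>] (Poly_Mapping.lookup f \<mu>))"

abbreviation e_pow :: "'v::real_vector \<Rightarrow> ('v \<Rightarrow>\<^sub>0 int)" where
  "e_pow \<mu> \<equiv> Poly_Mapping.single \<mu> 1"

definition braid_word :: "'i \<Rightarrow> 'i \<Rightarrow> nat \<Rightarrow> ('i, 'v) generator list" where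
  "braid_word i j m = map (\<lambda>k. gen_T (if even k then i else j)) [0..<m]"

text \<open>In the last family, \<open>q\<close> is the quotient of \<open>X\<^sup>\<mu> - X\<^bsup>s\<^sub>i\<mu>\<^esup>\<close> by
  \<open>1 - X\<^bsup>-\<alpha>\<^sub>i\<^esup>\<close> in the integral group algebra of the weight lattice, which is a domain.\<close>

definition hecke_relations ::
    "'v::real_vector set \<Rightarrow> ('i::finite \<Rightarrow> 'v) \<Rightarrow> ('i \<Rightarrow> 'v) \<Rightarrow> ('i, 'v, 'k::comm_ring_1) free_alg set"
  where
  "hecke_relations \<Phi> \<alpha> \<omega> =
     {wmon [gen_T i, gen_T i] - wmon [gen_T i] | i. True} \<union>
     {wmon (braid_word i j (coxeter_order \<Phi> \<alpha> i j)) -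
      wmon (braid_word j i (coxeter_order \<Phi> \<alpha> i j)) | i j. True} \<union>
     {wmon [gen_X \<mu>, gen_X \<nu>] - wmon [gen_X (\<mu> + \<nu>)] | \<mu> \<nu>. \<mu> \<in> weight_lattice \<omega> \<and> \<nu> \<in> weight_lattice \<omega>} \<union>
     {wmon [gen_X 0] - 1} \<union>
     {wmon [gen_X \<mu>, gen_T i] - wmon [gen_T i, gen_X (root_refl \<Phi> (\<alpha> i) \<mu>)] - X_sum (Poly_Mapping.map of_int q)
       | \<mu> i q. \<mu> \<in> weight_lattice \<omega> \<and> Poly_Mapping.keys q \<subseteq> weight_lattice \<omega> \<and>
                q * (1 - e_pow (- \<alpha> i)) = e_pow \<mu> - e_pow (root_refl \<Phi> (\<alpha> i) \<mu>)}"

definition hecke_ideal ::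
    "'v::real_vector set \<Rightarrow> ('i::finite \<Rightarrow> 'v) \<Rightarrow> ('i \<Rightarrow> 'v) \<Rightarrow> 'k::comm_ring_1 set \<Rightarrow>
     ('i, 'v, 'k) free_alg set" where
  "hecke_ideal \<Phi> \<alpha> \<omega> S =
     genideal (free_algebra (weight_lattice \<omega>) S) (hecke_relations \<Phi> \<alpha> \<omega>)"

text \<open>The algebra with coefficients \<open>S\<close>: for \<open>S = \<int>\<close> this is the affine nil-Hecke
  algebra, and in general it is its base change from \<open>\<int>\<close> to \<open>S\<close>, because base change
  keeps generators and relations.\<close>

definition nil_hecke ::
    "'v::real_vector set \<Rightarrow> ('i::finite \<Rightarrow> 'v) \<Rightarrow> ('i \<Rightarrow> 'v) \<Rightarrow> 'k::comm_ring_1 set \<Rightarrow>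
     ('i, 'v, 'k) free_alg set ring" where
  "nil_hecke \<Phi> \<alpha> \<omega> S =
     free_algebra (weight_lattice \<omega>) S Quot hecke_ideal \<Phi> \<alpha> \<omega> S"

definition hecke_class ::
    "'v::real_vector set \<Rightarrow> ('i::finite \<Rightarrow> 'v) \<Rightarrow> ('i \<Rightarrow> 'v) \<Rightarrow> 'k::comm_ring_1 set \<Rightarrow>
     ('i, 'v, 'k) free_alg \<Rightarrow> ('i, 'v, 'k) free_alg set" where
  "hecke_class \<Phi> \<alpha> \<omega> S x =
     hecke_ideal \<Phi> \<alpha> \<omega> S +>\<^bsub>free_algebra (weight_lattice \<omega>) S\<^esub> x"

section \<open>The module \<open>K\<^sub>T(G/B)\<close>\<close>

text \<open>Unlike the library's \<open>module\<close>, this does not require the scalars to commute.\<close>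

locale left_module = A?: ring A + M?: abelian_group M
  for A (structure) and M :: "('a, 'm, 'c) module_scheme" (structure) +
  assumes smult_closed: "a \<in> carrier A \<Longrightarrow> x \<in> carrier M \<Longrightarrow> a \<odot>\<^bsub>M\<^esub> x \<in> carrier M"
    and smult_l_distr: "a \<in> carrier A \<Longrightarrow> b \<in> carrier A \<Longrightarrow> x \<in> carrier M \<Longrightarrow>
      (a \<oplus>\<^bsub>A\<^esub> b) \<odot>\<^bsub>M\<^esub> x = a \<odot>\<^bsub>M\<^esub> x \<oplus>\<^bsub>M\<^esub> b \<odot>\<^bsub>M\<^esub> x"
    and smult_r_distr: "a \<in> carrier A \<Longrightarrow> x \<in> carrier M \<Longrightarrow> y \<in> carrier M \<Longrightarrow>
      a \<odot>\<^bsub>M\<^esub> (x \<oplus>\<^bsub>M\<^esub> y) = a \<odot>\<^bsub>M\<^esub> x \<oplus>\<^bsub>M\<^esub> a \<odot>\<^bsub>M\<^esub> y"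
    and smult_assoc: "a \<in> carrier A \<Longrightarrow> b \<in> carrier A \<Longrightarrow> x \<in> carrier M \<Longrightarrow>
      (a \<otimes>\<^bsub>A\<^esub> b) \<odot>\<^bsub>M\<^esub> x = a \<odot>\<^bsub>M\<^esub> (b \<odot>\<^bsub>M\<^esub> x)"
    and smult_one: "x \<in> carrier M \<Longrightarrow> \<one>\<^bsub>A\<^esub> \<odot>\<^bsub>M\<^esub> x = x"

definition coeff_ring :: "('i::finite \<Rightarrow> 'v::real_vector) \<Rightarrow> ('v \<Rightarrow>\<^sub>0 int) set" where
  "coeff_ring \<omega> = {f. Poly_Mapping.keys f \<subseteq> weight_lattice \<omega>}"

type_synonym ('i, 'v) hecke_R = "('i, 'v, 'v \<Rightarrow>\<^sub>0 int) free_alg set"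

definition hecke_R :: "'v::real_vector set \<Rightarrow> ('i::finite \<Rightarrow> 'v) \<Rightarrow> ('i \<Rightarrow> 'v) \<Rightarrow> ('i, 'v) hecke_R ring"
  where "hecke_R \<Phi> \<alpha> \<omega> = nil_hecke \<Phi> \<alpha> \<omega> (coeff_ring \<omega>)"

definition T_elt ::
    "'v::real_vector set \<Rightarrow> ('i::finite \<Rightarrow> 'v) \<Rightarrow> ('i \<Rightarrow> 'v) \<Rightarrow> 'i \<Rightarrow> ('i, 'v) hecke_R" where
  "T_elt \<Phi> \<alpha> \<omega> i = hecke_class \<Phi> \<alpha> \<omega> (coeff_ring \<omega>) (wmon [gen_T i])"

definition X_elt ::
    "'v::real_vector set \<Rightarrow> ('i::finite \<Rightarrow> 'v) \<Rightarrow> ('i \<Rightarrow> 'v) \<Rightarrow> 'v \<Rightarrow> ('i, 'v) hecke_R" where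
  "X_elt \<Phi> \<alpha> \<omega> \<mu> = hecke_class \<Phi> \<alpha> \<omega> (coeff_ring \<omega>) (wmon [gen_X \<mu>])"

text \<open>The structure map \<open>r \<mapsto> r \<cdot> 1\<close> from the coefficients to the algebra.\<close>

definition scalar ::
    "'v::real_vector set \<Rightarrow> ('i::finite \<Rightarrow> 'v) \<Rightarrow> ('i \<Rightarrow> 'v) \<Rightarrow> ('v \<Rightarrow>\<^sub>0 int) \<Rightarrow> ('i, 'v) hecke_R" where
  "scalar \<Phi> \<alpha> \<omega> r = hecke_class \<Phi> \<alpha> \<omega> (coeff_ring \<omega>) (Poly_Mapping.single [] r)"

text \<open>\<open>R[X]\<close>, as a ring: the \<open>R\<close>-span of the \<open>X\<^sup>\<mu>\<close> inside the algebra.\<close>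

definition RX :: "'v::real_vector set \<Rightarrow> ('i::finite \<Rightarrow> 'v) \<Rightarrow> ('i \<Rightarrow> 'v) \<Rightarrow> ('i, 'v) hecke_R ring" where
  "RX \<Phi> \<alpha> \<omega> = hecke_R \<Phi> \<alpha> \<omega> \<lparr>carrier :=
     {hecke_class \<Phi> \<alpha> \<omega> (coeff_ring \<omega>) (X_sum f) | f.
        Poly_Mapping.keys f \<subseteq> weight_lattice \<omega> \<and>
        (\<forall>\<mu>. Poly_Mapping.lookup f \<mu> \<in> coeff_ring \<omega>)}\<rparr>"

text \<open>\<open>\<O> w\<close> stands for the class of the structure sheaf of \<open>X\<^sub>w\<close>. The elements of the Weyl
  group are functions on the vector space, so \<open>ws\<^sub>i\<close> is \<open>w \<circ> root_refl \<Phi> (\<alpha> i)\<close>.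

  Assumption \<open>ring_structure\<close> transports the multiplication of \<open>R[X]\<close> to \<open>K\<close> along
  \<open>f \<mapsto> f \<odot> \<O> w0\<close>. It leaves no freedom in the ring structure, since that map is onto.\<close>

locale KT_flag_variety =
  fixes \<Phi> :: "'v::real_vector set"
    and \<alpha> \<omega> :: "'i::finite \<Rightarrow> 'v"
    and w0 :: "'v \<Rightarrow> 'v"
    and K :: "(('i, 'v) hecke_R, 'm) module"
    and \<O> :: "('v \<Rightarrow> 'v) \<Rightarrow> 'm"
  assumes root_system: "root_system \<Phi>" "reduced \<Phi>" "irreducible_roots \<Phi>"
    and simple_roots: "simple_roots \<Phi> \<alpha>"
    and fundamental_weights: "fundamental_weights \<Phi> \<alpha> \<omega>"
    and longest_element: "longest_element \<Phi> \<alpha> w0"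
    and left_module: "left_module (hecke_R \<Phi> \<alpha> \<omega>) K"
    and basis_closed: "w \<in> weyl \<Phi> \<Longrightarrow> \<O> w \<in> carrier K"
    and basis: "m \<in> carrier K \<Longrightarrow>
      \<exists>!r. r \<in> weyl \<Phi> \<rightarrow>\<^sub>E coeff_ring \<omega> \<and>
           m = (\<Oplus>\<^bsub>K\<^esub>w\<in>weyl \<Phi>. scalar \<Phi> \<alpha> \<omega> (r w) \<odot>\<^bsub>K\<^esub> \<O> w)"
    and X_action: "\<mu> \<in> weight_lattice \<omega> \<Longrightarrow>
      X_elt \<Phi> \<alpha> \<omega> \<mu> \<odot>\<^bsub>K\<^esub> \<O> id = scalar \<Phi> \<alpha> \<omega> (e_pow \<mu>) \<odot>\<^bsub>K\<^esub> \<O> id"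
    and T_action_up: "w \<in> weyl \<Phi> \<Longrightarrow> bruhat_less \<Phi> \<alpha> w (w \<circ> root_refl \<Phi> (\<alpha> i)) \<Longrightarrow>
      T_elt \<Phi> \<alpha> \<omega> i \<odot>\<^bsub>K\<^esub> \<O> w = \<O> (w \<circ> root_refl \<Phi> (\<alpha> i))"
    and T_action_down: "w \<in> weyl \<Phi> \<Longrightarrow> bruhat_less \<Phi> \<alpha> (w \<circ> root_refl \<Phi> (\<alpha> i)) w \<Longrightarrow>
      T_elt \<Phi> \<alpha> \<omega> i \<odot>\<^bsub>K\<^esub> \<O> w = \<O> w"
    and ring_structure: "(\<lambda>f. f \<odot>\<^bsub>K\<^esub> \<O> w0) \<in> ring_hom (RX \<Phi> \<alpha> \<omega>) K"

lemma (in KT_flag_variety) one_eq: "\<one>\<^bsub>K\<^esub> = \<O> w0"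
proof -
  have *: "\<one>\<^bsub>hecke_R \<Phi> \<alpha> \<omega>\<^esub> \<odot>\<^bsub>K\<^esub> \<O> w0 = \<one>\<^bsub>K\<^esub>"
    using ring_structure by (simp add: ring_hom_def RX_def)
  have "\<O> w0 \<in> carrier K"
    using basis_closed longest_element by (simp add: longest_element_def)
  from left_module.smult_one[OF left_module this] have "\<one>\<^bsub>hecke_R \<Phi> \<alpha> \<omega>\<^esub> \<odot>\<^bsub>K\<^esub> \<O> w0 = \<O> w0" .
  with * show ?thesis by simp
qed

definition X_class ::
    "'v::real_vector set \<Rightarrow> ('i::finite \<Rightarrow> 'v) \<Rightarrow> ('i \<Rightarrow> 'v) \<Rightarrow> ('v \<Rightarrow> 'v) \<Rightarrow>
     (('i, 'v) hecke_R, 'm) module \<Rightarrow> (('v \<Rightarrow> 'v) \<Rightarrow> 'm) \<Rightarrow> 'v \<Rightarrow> 'm" where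
  "X_class \<Phi> \<alpha> \<omega> w0 K \<O> \<mu> = X_elt \<Phi> \<alpha> \<omega> \<mu> \<odot>\<^bsub>K\<^esub> \<O> w0"

end

theory Submission
  imports Defs
begin

text \<open>Put \<open>m = X\<^bsup>-\<omega>\<^sub>i\<^esup> \<O> w\<^sub>0\<close>. For \<open>j \<noteq> i\<close> the element
  \<open>X\<^bsup>-\<omega>\<^sub>i\<^esup>\<close> commutes with \<open>T\<^sub>j\<close>, so \<open>T\<^sub>j m = m\<close>; and
  \<open>X\<^bsup>-\<omega>\<^sub>i\<^esup>T\<^sub>i = (T\<^sub>i - 1)X\<^bsup>-s\<^sub>i\<omega>\<^sub>i\<^esup>\<close>, so \<open>T\<^sub>i m = 0\<close>. In the basis of
  Schubert classes the first condition says that the coefficient of \<open>m\<close> at \<open>w\<close> vanishes unless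
  \<open>ws\<^sub>j < w\<close> for all \<open>j \<noteq> i\<close>, and the second that the coefficients at \<open>w\<close> and
  \<open>ws\<^sub>i\<close> are opposite. An element all of whose right multiples by simple reflections are
  shorter is \<open>w\<^sub>0\<close>, so \<open>m\<close> is a multiple of \<open>\<O> w\<^sub>0 - \<O> (w\<^sub>0s\<^sub>i)\<close>. The
  factor is \<open>e\<^bsup>-w\<^sub>0\<omega>\<^sub>i\<^esup>\<close>, because \<open>X\<^sup>\<mu>\<close> multiplies \<open>\<O> w\<close> by
  \<open>e\<^bsup>w\<mu>\<^esup>\<close> up to terms of smaller length.\<close>

section \<open>Root systems and the length function\<close>

locale based_root_system =
  fixes \<Phi> :: "'v::real_vector set" and \<alpha> :: "'i::finite \<Rightarrow> 'v"
  assumes root_system: "root_system \<Phi>"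
    and reduced: "reduced \<Phi>"
    and simple_roots: "simple_roots \<Phi> \<alpha>"
begin

abbreviation s :: "'i \<Rightarrow> 'v \<Rightarrow> 'v" where "s j \<equiv> root_refl \<Phi> (\<alpha> j)"
abbreviation len :: "('v \<Rightarrow> 'v) \<Rightarrow> nat" where "len \<equiv> weyl_length \<Phi> \<alpha>"
abbreviation word :: "'i list \<Rightarrow> 'v \<Rightarrow> 'v" where "word \<equiv> simple_word \<Phi> \<alpha>"

definition comb :: "('i \<Rightarrow> real) \<Rightarrow> 'v" where
  "comb c = (\<Sum>k\<in>UNIV. c k *\<^sub>R \<alpha> k)"

definition positive :: "'v \<Rightarrow> bool" where
  "positive \<beta> \<longleftrightarrow> \<beta> \<in> \<Phi> \<and> (\<exists>c :: 'i \<Rightarrow> nat. \<beta> = comb (\<lambda>k. real (c k)))"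

section \<open>Coroots, reflections and an invariant inner product\<close>

lemma finite_roots: "finite \<Phi>" and zero_not_root: "0 \<notin> \<Phi>" and span_roots: "span \<Phi> = UNIV"
  using root_system by (auto simp: root_system_def)

lemma is_coroot_coroot: "\<beta> \<in> \<Phi> \<Longrightarrow> is_coroot \<Phi> \<beta> (coroot \<Phi> \<beta>)"
  unfolding coroot_def using root_system
  by (intro theI'[where P = "is_coroot \<Phi> \<beta>"])
    (meson is_coroot_unique[OF finite_roots zero_not_root span_roots] root_system_def)

lemma coroot_eqI: "\<beta> \<in> \<Phi> \<Longrightarrow> is_coroot \<Phi> \<beta> f \<Longrightarrow> coroot \<Phi> \<beta> = f"
  using is_coroot_coroot is_coroot_unique[OF finite_roots zero_not_root span_roots] by blast

lemma linear_coroot: "\<beta> \<in> \<Phi> \<Longrightarrow> linear (coroot \<Phi> \<beta>)"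
  and coroot_self: "\<beta> \<in> \<Phi> \<Longrightarrow> coroot \<Phi> \<beta> \<beta> = 2"
  and coroot_Ints: "\<beta> \<in> \<Phi> \<Longrightarrow> \<gamma> \<in> \<Phi> \<Longrightarrow> coroot \<Phi> \<beta> \<gamma> \<in> \<int>"
  and refl_root: "\<beta> \<in> \<Phi> \<Longrightarrow> \<gamma> \<in> \<Phi> \<Longrightarrow> root_refl \<Phi> \<beta> \<gamma> \<in> \<Phi>"
  using is_coroot_coroot by (auto simp: is_coroot_def root_refl_def)

lemma linear_refl: "\<beta> \<in> \<Phi> \<Longrightarrow> linear (root_refl \<Phi> \<beta>)"
  unfolding root_refl_def
  by (rule linearI) (simp_all add: linear_coroot linear_add linear_scale algebra_simps)

lemma refl_refl: "\<beta> \<in> \<Phi> \<Longrightarrow> root_refl \<Phi> \<beta> (root_refl \<Phi> \<beta> v) = v"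
  by (simp add: root_refl_def linear_coroot linear_diff linear_scale coroot_self)

lemma refl_self: "\<beta> \<in> \<Phi> \<Longrightarrow> root_refl \<Phi> \<beta> \<beta> = - \<beta>"
  by (simp add: root_refl_def coroot_self scaleR_2)

lemma neg_root: "\<beta> \<in> \<Phi> \<Longrightarrow> - \<beta> \<in> \<Phi>"
  using refl_root[of \<beta> \<beta>] refl_self by simp

text \<open>By uniqueness of coroots it is enough that the coroot of \<gamma>, composed with the
  reflection in \<beta>, meets the conditions of \<open>is_coroot\<close> for the reflected
  root.\<close>

lemma coroot_refl:
  assumes "\<beta> \<in> \<Phi>" "\<gamma> \<in> \<Phi>"
  shows "coroot \<Phi> (root_refl \<Phi> \<beta> \<gamma>) v = coroot \<Phi> \<gamma> (root_refl \<Phi> \<beta> v)"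
proof -
  have "is_coroot \<Phi> (root_refl \<Phi> \<beta> \<gamma>) (coroot \<Phi> \<gamma> \<circ> root_refl \<Phi> \<beta>)"
    unfolding is_coroot_def
  proof (intro conjI ballI)
    show "linear (coroot \<Phi> \<gamma> \<circ> root_refl \<Phi> \<beta>)"
      using assms by (intro linear_compose linear_refl linear_coroot)
    show "(coroot \<Phi> \<gamma> \<circ> root_refl \<Phi> \<beta>) (root_refl \<Phi> \<beta> \<gamma>) = 2"
      using assms by (simp add: refl_refl coroot_self)
    fix \<delta> assume \<delta>: "\<delta> \<in> \<Phi>"
    show "(coroot \<Phi> \<gamma> \<circ> root_refl \<Phi> \<beta>) \<delta> \<in> \<int>"
      using assms \<delta> by (simp add: coroot_Ints refl_root)
    have "root_refl \<Phi> \<beta> (root_refl \<Phi> \<gamma> (root_refl \<Phi> \<beta> \<delta>)) \<in> \<Phi>"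
      using assms \<delta> by (simp add: refl_root)
    also have "root_refl \<Phi> \<beta> (root_refl \<Phi> \<gamma> (root_refl \<Phi> \<beta> \<delta>)) =
        \<delta> - (coroot \<Phi> \<gamma> \<circ> root_refl \<Phi> \<beta>) \<delta> *\<^sub>R root_refl \<Phi> \<beta> \<gamma>"
      using assms by (simp add: root_refl_def[of _ \<gamma>] linear_diff linear_scale linear_refl refl_refl)
    finally show "\<delta> - (coroot \<Phi> \<gamma> \<circ> root_refl \<Phi> \<beta>) \<delta> *\<^sub>R root_refl \<Phi> \<beta> \<gamma> \<in> \<Phi>" .
  qed
  from coroot_eqI[OF _ this] assms show ?thesis by (simp add: refl_root)
qed

lemma refl_conj:
  assumes "\<beta> \<in> \<Phi>" "\<gamma> \<in> \<Phi>"
  shows "root_refl \<Phi> (root_refl \<Phi> \<beta> \<gamma>) (root_refl \<Phi> \<beta> v) = root_refl \<Phi> \<beta> (root_refl \<Phi> \<gamma> v)"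
  using assms
  by (simp add: root_refl_def[of _ "root_refl \<Phi> \<beta> \<gamma>"] root_refl_def[of _ \<gamma>]
      coroot_refl refl_refl linear_diff linear_scale linear_refl)

text \<open>The case \<gamma> = \<beta> of \<open>refl_conj\<close> makes the reflection in -\<beta>
  an inverse of the reflection in \<beta>, which is its own inverse.\<close>

lemma refl_uminus: "\<beta> \<in> \<Phi> \<Longrightarrow> root_refl \<Phi> (- \<beta>) = root_refl \<Phi> \<beta>"
  using refl_conj[of \<beta> \<beta>] by (metis refl_refl refl_self ext)

text \<open>A reflection-invariant inner product, available although \<open>'v\<close> carries none.\<close>

definition form :: "'v \<Rightarrow> 'v \<Rightarrow> real" where
  "form x y = (\<Sum>\<gamma>\<in>\<Phi>. coroot \<Phi> \<gamma> x * coroot \<Phi> \<gamma> y)"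

text \<open>Reflecting both arguments only permutes the summands, because a coroot precomposed with
  a reflection is the coroot of the reflected root.\<close>

lemma form_refl:
  assumes "\<beta> \<in> \<Phi>"
  shows "form (root_refl \<Phi> \<beta> x) (root_refl \<Phi> \<beta> y) = form x y"
  unfolding form_def
  by (rule sum.reindex_bij_witness[where i = "root_refl \<Phi> \<beta>" and j = "root_refl \<Phi> \<beta>"])
    (use assms in \<open>auto simp: refl_refl refl_root coroot_refl\<close>)

lemma linear_form: "linear (form x)"
  by (rule linearI)
    (simp_all add: form_def linear_coroot linear_add linear_scale distrib_left sum.distrib
      sum_distrib_left mult.left_commute)

lemma form_commute: "form x y = form y x"
  by (simp add: form_def mult.commute)

lemma form_root_pos: "\<beta> \<in> \<Phi> \<Longrightarrow> form \<beta> \<beta> > 0"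
  unfolding form_def by (rule sum_pos2[of _ \<beta>]) (auto simp: finite_roots coroot_self)

text \<open>Invariance under the reflection in \<beta>, which negates \<beta>, expands to the
  classical formula 2(\<beta>, x) / (\<beta>, \<beta>) for the coroot. Its sign is therefore that of
  the form.\<close>

lemma form_coroot:
  assumes "\<beta> \<in> \<Phi>"
  shows "2 * form \<beta> x = coroot \<Phi> \<beta> x * form \<beta> \<beta>"
proof -
  have "form \<beta> x = form (- \<beta>) (root_refl \<Phi> \<beta> x)"
    using form_refl[OF assms, of \<beta> x] refl_self[OF assms] by simp
  also have "\<dots> = - form \<beta> (root_refl \<Phi> \<beta> x)"
    by (metis form_commute linear_form linear_neg)
  also have "form \<beta> (root_refl \<Phi> \<beta> x) = form \<beta> x - coroot \<Phi> \<beta> x * form \<beta> \<beta>"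
    by (simp add: root_refl_def linear_form linear_diff linear_scale)
  finally show ?thesis by simp
qed

section \<open>Positive roots and simple reflections\<close>

lemma simple_root: "\<alpha> j \<in> \<Phi>"
  using simple_roots by (auto simp: simple_roots_def)

lemma comb_inj:
  assumes "comb a = comb b"
  shows "a k = b k"
proof -
  have inj: "inj \<alpha>" and ind: "independent (range \<alpha>)"
    using simple_roots by (auto simp: simple_roots_def)
  \<comment> \<open>The independence criterion attaches coefficients to vectors, so indices are
    recovered through the inverse of the injective map \<open>\<alpha>\<close>.\<close>
  have "(\<Sum>v\<in>range \<alpha>. (a (inv_into UNIV \<alpha> v) - b (inv_into UNIV \<alpha> v)) *\<^sub>R v) = comb a - comb b"
    using inj by (simp add: comb_def sum.reindex scaleR_diff_left sum_subtractf)
  then have "a (inv_into UNIV \<alpha> (\<alpha> k)) - b (inv_into UNIV \<alpha> (\<alpha> k)) = 0"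
    using assms by (intro independentD[OF ind, of "range \<alpha>"]) auto
  then show ?thesis using inj by simp
qed

lemma comb_diff_simple: "comb c - x *\<^sub>R \<alpha> j = comb (c(j := c j - x))"
proof -
  have "comb (c(j := c j - x)) = (\<Sum>k\<in>UNIV. c k *\<^sub>R \<alpha> k - (if k = j then x *\<^sub>R \<alpha> j else 0))"
    unfolding comb_def by (rule sum.cong) (auto simp: scaleR_diff_left)
  then show ?thesis by (simp add: sum_subtractf comb_def)
qed

lemma comb_uminus: "- comb c = comb (\<lambda>k. - c k)"
  by (simp add: comb_def sum_negf)

lemma simple_comb: "\<alpha> j = comb (\<lambda>k. if k = j then 1 else 0)"
  by (simp add: comb_def if_distrib[of "\<lambda>x. x *\<^sub>R _"] cong: if_cong)

lemma positive_or_negative: "\<beta> \<in> \<Phi> \<Longrightarrow> positive \<beta> \<or> positive (- \<beta>)"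
  using simple_roots neg_root unfolding simple_roots_def positive_def comb_def
  by (metis minus_minus)

lemma not_positive_and_negative:
  assumes "positive \<beta>" shows "\<not> positive (- \<beta>)"
proof
  assume "positive (- \<beta>)"
  with assms obtain c d :: "'i \<Rightarrow> nat"
    where c: "\<beta> = comb (\<lambda>k. real (c k))" and d: "- \<beta> = comb (\<lambda>k. real (d k))"
    unfolding positive_def by blast
  have "real (c k) = - real (d k)" for k
    using c d by (intro comb_inj[of _ "\<lambda>k. - real (d k)"]) (metis comb_uminus minus_minus)
  then have "c k = 0" for k
    by (metis neg_le_0_iff_le of_nat_0_le_iff of_nat_le_0_iff)
  then have "\<beta> = 0" using c by (simp add: comb_def)
  then show False using assms zero_not_root by (simp add: positive_def)
qed

lemma positive_simple: "positive (\<alpha> j)"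
  unfolding positive_def
  by (intro conjI simple_root exI[of _ "\<lambda>k. if k = j then 1 else 0"])
    (subst simple_comb, intro arg_cong[of _ _ comb], auto)

text \<open>A simple reflection changes only the coefficient at \<open>j\<close>. If the image were
  negative, all other coefficients of \<beta> would be zero, so \<beta> would be a multiple of
  \<open>\<alpha> j\<close>, and reducedness leaves only \<open>\<alpha> j\<close> itself.\<close>

lemma positive_refl:
  assumes "positive \<beta>" "\<beta> \<noteq> \<alpha> j"
  shows "positive (s j \<beta>)"
proof (rule ccontr)
  assume "\<not> positive (s j \<beta>)"
  have root: "\<beta> \<in> \<Phi>" using assms by (simp add: positive_def)
  obtain c :: "'i \<Rightarrow> nat" where c: "\<beta> = comb (\<lambda>k. real (c k))"
    using assms unfolding positive_def by blast
  obtain d :: "'i \<Rightarrow> nat" where d: "- s j \<beta> = comb (\<lambda>k. real (d k))"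
    using \<open>\<not> positive (s j \<beta>)\<close> positive_or_negative[OF refl_root[OF simple_root root]]
    unfolding positive_def by blast
  let ?x = "coroot \<Phi> (\<alpha> j) \<beta>"
  have "s j \<beta> = comb ((\<lambda>k. real (c k))(j := real (c j) - ?x))"
    unfolding root_refl_def by (subst c) (rule comb_diff_simple)
  with d have eq: "comb ((\<lambda>k. real (c k))(j := real (c j) - ?x)) = comb (\<lambda>k. - real (d k))"
    by (metis comb_uminus minus_minus)
  have "c k = 0" if "k \<noteq> j" for k
    using comb_inj[OF eq, of k] that by simp
  then have "(\<lambda>k. real (c k)) = (\<lambda>k. if k = j then real (c j) else 0)" by auto
  then have "\<beta> = comb (\<lambda>k. if k = j then real (c j) else 0)" using c by simp
  then have \<beta>: "\<beta> = real (c j) *\<^sub>R \<alpha> j"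
    by (simp add: comb_def if_distrib[of "\<lambda>x. x *\<^sub>R _"] cong: if_cong)
  then have "real (c j) = 1 \<or> real (c j) = -1"
    using reduced simple_root root unfolding reduced_def by metis
  then have "real (c j) = 1" by linarith
  then show False using \<beta> assms by simp
qed

section \<open>Words in the simple reflections and generation of the Weyl group\<close>

lemma word_Nil [simp]: "word [] = id"
  and word_Cons: "word (j # js) = s j \<circ> word js"
  by (simp_all add: simple_word_def)

lemma word_append: "word (js @ ks) = word js \<circ> word ks"
  by (induction js) (simp_all add: word_Cons comp_assoc)

lemma word_snoc: "word (js @ [j]) = word js \<circ> s j"
  by (simp add: word_append word_Cons)

lemma word_rev: "word (rev js) (word js v) = v" "word js (word (rev js) v) = v"
  by (induction js arbitrary: v) (simp_all add: word_Cons word_append refl_refl simple_root)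

lemma simple_refl_word: "s j = word [j]"
  by (simp add: word_Cons)

text \<open>Induction on the height, the sum of the coefficients. Since the form is positive
  definite on roots, some \<open>\<alpha> j\<close> pairs positively with \<beta>; unless \<beta> is
  \<open>\<alpha> j\<close>, reflecting in it lowers the height, and conjugating by
  \<open>s j\<close> returns to \<beta>.\<close>

lemma positive_refl_word:
  assumes "positive \<beta>" shows "\<exists>js. root_refl \<Phi> \<beta> = word js"
proof -
  obtain c :: "'i \<Rightarrow> nat" where "\<beta> = comb (\<lambda>k. real (c k))"
    using assms unfolding positive_def by blast
  then show ?thesis using assms
  proof (induction "\<Sum>k\<in>UNIV. c k" arbitrary: \<beta> c rule: less_induct)
    case less
    have root: "\<beta> \<in> \<Phi>" using less.prems by (simp add: positive_def)
    have "0 < form \<beta> \<beta>" using root by (rule form_root_pos)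
    also have "form \<beta> \<beta> = form \<beta> (comb (\<lambda>k. real (c k)))" using less.prems(1) by simp
    also have "\<dots> = (\<Sum>k\<in>UNIV. real (c k) * form \<beta> (\<alpha> k))"
      unfolding comb_def by (simp add: linear_form linear_sum linear_scale)
    finally obtain j where "real (c j) * form \<beta> (\<alpha> j) > 0"
      using sum_nonpos[of UNIV "\<lambda>k. real (c k) * form \<beta> (\<alpha> k)"] by (meson not_less)
    then have "form \<beta> (\<alpha> j) > 0" by (simp add: zero_less_mult_iff)
    then have pos: "coroot \<Phi> (\<alpha> j) \<beta> > 0"
      using form_coroot[OF simple_root, of j \<beta>] form_root_pos[OF simple_root, of j]
      by (metis form_commute mult_pos_pos zero_less_mult_pos2 zero_less_numeral)
    show ?case
    proof (cases "\<beta> = \<alpha> j")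
      case True then show ?thesis using simple_refl_word by blast
    next
      case False
      have pos': "positive (s j \<beta>)" using less.prems(2) False by (rule positive_refl)
      then obtain d :: "'i \<Rightarrow> nat" where d: "s j \<beta> = comb (\<lambda>k. real (d k))"
        unfolding positive_def by blast
      let ?x = "coroot \<Phi> (\<alpha> j) \<beta>"
      have "s j \<beta> = comb ((\<lambda>k. real (c k))(j := real (c j) - ?x))"
        unfolding root_refl_def by (subst less.prems(1)) (rule comb_diff_simple)
      with d have "comb (\<lambda>k. real (d k)) = comb ((\<lambda>k. real (c k))(j := real (c j) - ?x))" by simp
      note eq = comb_inj[OF this]
      have "(\<Sum>k\<in>UNIV. d k) < (\<Sum>k\<in>UNIV. c k)"
      proof (rule sum_strict_mono_ex1)
        show "\<forall>k\<in>UNIV. d k \<le> c k"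
        proof
          fix k show "d k \<le> c k" using eq[of k] pos by (cases "k = j") auto
        qed
        show "\<exists>k\<in>UNIV. d k < c k" using eq[of j] pos by (intro bexI[of _ j]) auto
      qed simp
      from less.hyps[OF this d pos'] obtain js where js: "root_refl \<Phi> (s j \<beta>) = word js" by blast
      have "root_refl \<Phi> \<beta> = word (j # js @ [j])"
        using refl_conj[OF simple_root refl_root[OF simple_root root], of j j] js
        by (auto simp: word_Cons word_append refl_refl simple_root fun_eq_iff)
          (metis refl_refl simple_root)
      then show ?thesis by blast
    qed
  qed
qed

text \<open>The group is generated by all root reflections, while lengths count simple ones; the two
  descriptions agree because a negative root has the same reflection as its opposite.\<close>

lemma weyl_eq_words: "weyl \<Phi> = range word"
proof
  show "weyl \<Phi> \<subseteq> range word"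
  proof
    fix w assume "w \<in> weyl \<Phi>" then show "w \<in> range word"
    proof induction
      case weyl_id show ?case using rangeI[of word "[]"] by (simp only: word_Nil)
    next
      case (weyl_refl \<beta> w)
      obtain js where "root_refl \<Phi> \<beta> = word js"
        using positive_or_negative[OF weyl_refl.hyps(1)] positive_refl_word[of \<beta>]
          positive_refl_word[of "- \<beta>"] refl_uminus[OF weyl_refl.hyps(1)] by auto
      moreover obtain ks where "w = word ks" using weyl_refl.IH by auto
      ultimately have "root_refl \<Phi> \<beta> \<circ> w = word (js @ ks)" by (simp add: word_append)
      then show ?case by simp
    qed
  qed
  have "word js \<in> weyl \<Phi>" for js
    by (induction js) (simp_all only: word_Nil word_Cons weyl.intros simple_root)
  then show "range word \<subseteq> weyl \<Phi>" by blast
qed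

lemma weyl_word: "word js \<in> weyl \<Phi>"
  by (simp add: weyl_eq_words)

lemma weyl_comp_simple: "w \<in> weyl \<Phi> \<Longrightarrow> w \<circ> s j \<in> weyl \<Phi>"
  unfolding weyl_eq_words using rangeI[of word] by (auto simp flip: word_snoc)

lemma comp_simple_simple: "w \<circ> s j \<circ> s j = w"
  by (simp add: fun_eq_iff refl_refl simple_root)

lemma linear_weyl: "w \<in> weyl \<Phi> \<Longrightarrow> linear w"
  by (induction rule: weyl.induct) (simp_all only: linear_id linear_compose linear_refl)

lemma weyl_root: "w \<in> weyl \<Phi> \<Longrightarrow> \<gamma> \<in> \<Phi> \<Longrightarrow> w \<gamma> \<in> \<Phi>"
  by (induction rule: weyl.induct) (auto simp: refl_root)

lemma weyl_conj:
  "w \<in> weyl \<Phi> \<Longrightarrow> \<gamma> \<in> \<Phi> \<Longrightarrow> root_refl \<Phi> (w \<gamma>) (w v) = w (root_refl \<Phi> \<gamma> v)"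
  by (induction rule: weyl.induct) (auto simp: refl_conj weyl_root)

text \<open>An element is determined by its action on the roots, which span. Restricting to \<Phi>
  discards the values elsewhere, so that the images lie in a finite function space.\<close>

lemma finite_weyl: "finite (weyl \<Phi>)"
proof (rule inj_on_finite)
  show "inj_on (\<lambda>w. restrict w \<Phi>) (weyl \<Phi>)"
  proof
    fix u w assume u: "u \<in> weyl \<Phi>" and w: "w \<in> weyl \<Phi>" and eq: "restrict u \<Phi> = restrict w \<Phi>"
    have "u \<gamma> = w \<gamma>" if "\<gamma> \<in> \<Phi>" for \<gamma>
      using fun_cong[OF eq, of \<gamma>] that by simp
    then show "u = w"
      using linear_eq_on[OF linear_weyl[OF u] linear_weyl[OF w], of _ \<Phi>] span_roots by auto
  qed
  show "(\<lambda>w. restrict w \<Phi>) ` weyl \<Phi> \<subseteq> \<Phi> \<rightarrow>\<^sub>E \<Phi>" by (auto simp: weyl_root)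
  show "finite (\<Phi> \<rightarrow>\<^sub>E \<Phi>)" by (intro finite_PiE finite_roots)
qed

section \<open>Length, exchange, Bruhat order and descents\<close>

lemma len_word: "len (word js) \<le> length js"
  unfolding weyl_length_def by (rule Least_le) auto

lemma reduced_word:
  assumes "w \<in> weyl \<Phi>" obtains js where "length js = len w" "word js = w"
proof -
  have "\<exists>k js. length js = k \<and> word js = w" using assms by (auto simp: weyl_eq_words)
  from LeastI_ex[OF this] show ?thesis using that unfolding weyl_length_def by blast
qed

lemma len_comp_simple: "w \<in> weyl \<Phi> \<Longrightarrow> len (w \<circ> s j) \<le> Suc (len w)"
  by (metis reduced_word len_word word_snoc length_append_singleton)

text \<open>The exchange condition. Letting the letters act one after another from the right, the
  image of \<open>\<alpha> j\<close> starts positive and ends negative; a letter at which it turns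
  negative cancels against \<open>s j\<close>.\<close>

lemma exchange:
  assumes "positive (- word js (\<alpha> j))"
  shows "\<exists>ks. word js \<circ> s j = word ks \<and> length ks < length js"
  using assms
proof (induction js)
  case Nil
  then show ?case using not_positive_and_negative positive_simple by auto
next
  case (Cons k js)
  let ?\<beta> = "word js (\<alpha> j)"
  have root: "?\<beta> \<in> \<Phi>" by (simp add: weyl_root weyl_word simple_root)
  show ?case
  proof (cases "positive (- ?\<beta>)")
    case True
    from Cons.IH[OF this] obtain ks where "word js \<circ> s j = word ks" "length ks < length js" by blast
    then have "word (k # js) \<circ> s j = word (k # ks)" "length (k # ks) < length (k # js)"
      by (auto simp: word_Cons comp_assoc)
    then show ?thesis by blast
  next
    case False
    then have "positive ?\<beta>" using positive_or_negative[OF root] by blast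
    moreover have "\<not> positive (s k ?\<beta>)"
      using Cons.prems not_positive_and_negative[of "s k ?\<beta>"] by (auto simp: word_Cons)
    \<comment> \<open>The only positive root that \<open>s k\<close> makes negative is
      \<open>\<alpha> k\<close>.\<close>
    ultimately have \<beta>: "?\<beta> = \<alpha> k" using positive_refl by blast
    \<comment> \<open>Conjugation turns \<open>s j\<close> into the reflection in
      \<open>?\<beta>\<close>, which is \<open>s k\<close>, so the first letter drops out.\<close>
    have "word (k # js) (s j v) = word js v" for v
    proof -
      have "word (k # js) (s j v) = s k (root_refl \<Phi> ?\<beta> (word js v))"
        by (simp add: word_Cons weyl_conj weyl_word simple_root)
      then show ?thesis by (simp add: \<beta> refl_refl simple_root)
    qed
    then show ?thesis by (intro exI[of _ js]) (simp add: fun_eq_iff)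
  qed
qed

lemma len_descent:
  assumes w: "w \<in> weyl \<Phi>" and "positive (- w (\<alpha> j))"
  shows "len (w \<circ> s j) < len w"
proof -
  obtain js where js: "length js = len w" "word js = w" using w by (rule reduced_word)
  with assms obtain ks where "w \<circ> s j = word ks" "length ks < length js"
    using exchange by blast
  then show ?thesis using js len_word[of ks] by simp
qed

text \<open>Replacing \<open>w\<close> by \<open>w \<circ> s j\<close> reverses the sign of the
  image of \<open>\<alpha> j\<close>, so this is \<open>len_descent\<close> read backwards.\<close>

lemma len_ascent:
  assumes w: "w \<in> weyl \<Phi>" and pos: "positive (w (\<alpha> j))"
  shows "len w < len (w \<circ> s j)"
proof -
  have "positive (- (w \<circ> s j) (\<alpha> j))"
    using pos by (simp add: refl_self simple_root linear_weyl[OF w] linear_neg)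
  from len_descent[OF weyl_comp_simple[OF w] this] show ?thesis by (simp only: comp_simple_simple)
qed

text \<open>The action of \<open>T_elt\<close> on Schubert classes is governed by the Bruhat order.
  The sign of a single root decides the comparison, since one multiplication by \<open>s j\<close>
  that changes the length is a step of that order.\<close>

lemma bruhat_descent:
  "w \<in> weyl \<Phi> \<Longrightarrow> positive (- w (\<alpha> j)) \<Longrightarrow> bruhat_less \<Phi> \<alpha> (w \<circ> s j) w"
  unfolding bruhat_less_def bruhat_step_def
  using len_descent weyl_comp_simple simple_root comp_simple_simple[symmetric]
  by (intro tranclp.r_into_trancl) blast

lemma bruhat_ascent:
  "w \<in> weyl \<Phi> \<Longrightarrow> positive (w (\<alpha> j)) \<Longrightarrow> bruhat_less \<Phi> \<alpha> w (w \<circ> s j)"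
  unfolding bruhat_less_def bruhat_step_def
  using len_ascent weyl_comp_simple simple_root
  by (intro tranclp.r_into_trancl) blast

lemma weyl_sign: "w \<in> weyl \<Phi> \<Longrightarrow> positive (w (\<alpha> j)) \<or> positive (- w (\<alpha> j))"
  by (simp add: positive_or_negative weyl_root simple_root)

text \<open>The last letter of a nonempty reduced word is a descent.\<close>

lemma weyl_neq_id_descent:
  assumes w: "w \<in> weyl \<Phi>" and "w \<noteq> id"
  obtains j where "positive (- w (\<alpha> j))" "len (w \<circ> s j) < len w"
proof -
  obtain js where js: "length js = len w" "word js = w" using w by (rule reduced_word)
  with \<open>w \<noteq> id\<close> have "js \<noteq> []" by auto
  then obtain ks j where ks: "js = ks @ [j]" by (metis rev_exhaust)
  then have "w \<circ> s j = word ks" using js by (metis word_snoc comp_simple_simple)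
  then have lt: "len (w \<circ> s j) < len w" using js ks len_word[of ks] by simp
  then have "\<not> positive (w (\<alpha> j))" using len_ascent[OF w] by fastforce
  then show ?thesis using that lt weyl_sign[OF w] by blast
qed

text \<open>Expanding \<beta> in simple roots, and then each negated image, gives coefficients that
  are sums of products of natural numbers.\<close>

lemma negates_positive:
  assumes w: "w \<in> weyl \<Phi>" and neg: "\<And>j. positive (- w (\<alpha> j))" and "positive \<beta>"
  shows "positive (- w \<beta>)"
proof -
  obtain c :: "'i \<Rightarrow> nat" where c: "\<beta> = comb (\<lambda>k. real (c k))"
    using assms unfolding positive_def by blast
  have "\<exists>d :: 'i \<Rightarrow> nat. - w (\<alpha> k) = comb (\<lambda>l. real (d l))" for k
    using neg[of k] unfolding positive_def by blast
  then obtain d :: "'i \<Rightarrow> 'i \<Rightarrow> nat" where d: "\<And>k. - w (\<alpha> k) = comb (\<lambda>l. real (d k l))"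
    by metis
  have eq: "- w \<beta> = (\<Sum>k\<in>UNIV. real (c k) *\<^sub>R (- w (\<alpha> k)))"
    unfolding c comb_def using linear_weyl[OF w]
    by (simp add: linear_sum linear_scale sum_negf)
  have "- w \<beta> = comb (\<lambda>l. real (\<Sum>k\<in>UNIV. c k * d k l))"
    unfolding eq d unfolding comb_def scaleR_sum_right
    by (subst sum.swap) (simp add: scaleR_sum_left)
  moreover have "- w \<beta> \<in> \<Phi>"
    using assms(3) by (intro neg_root weyl_root[OF w]) (simp add: positive_def)
  ultimately show ?thesis unfolding positive_def by (intro conjI exI)
qed

text \<open>If the quotient \<open>v\<close> of \<open>u\<close> and \<open>w\<close> were not the
  identity, it would have a descent at some \<open>j\<close>; then \<open>u\<close> would turn the
  positive root \<open>- v (\<alpha> j)\<close> negative, which makes \<open>w (\<alpha> j)\<close>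
  positive.\<close>

lemma all_descents_unique:
  assumes u: "u \<in> weyl \<Phi>" "\<And>j. positive (- u (\<alpha> j))"
    and w: "w \<in> weyl \<Phi>" "\<And>j. positive (- w (\<alpha> j))"
  shows "u = w"
proof -
  obtain js where js: "u = word js" using u by (auto simp: weyl_eq_words)
  obtain ks where ks: "w = word ks" using w by (auto simp: weyl_eq_words)
  \<comment> \<open>The inverse of \<open>u\<close> followed on the right by \<open>w\<close>;
    reversing a word inverts it.\<close>
  define v where "v = word (rev js @ ks)"
  have v: "v \<in> weyl \<Phi>" by (simp add: v_def weyl_word)
  have uv: "u (v x) = w x" for x
    by (simp add: v_def js ks word_append word_rev)
  have "\<not> positive (- v (\<alpha> j))" for j
  proof
    assume "positive (- v (\<alpha> j))"
    then have "positive (- u (- v (\<alpha> j)))" by (rule negates_positive[OF u])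
    then have "positive (w (\<alpha> j))" using linear_weyl[OF u(1)] by (simp add: linear_neg uv)
    then show False using w(2) not_positive_and_negative by blast
  qed
  then have "v = id" using weyl_neq_id_descent[OF v] by blast
  then show ?thesis using uv by (simp add: fun_eq_iff)
qed

lemma longest_element_descent:
  assumes "longest_element \<Phi> \<alpha> w0" shows "positive (- w0 (\<alpha> j))"
proof (rule ccontr)
  have w0: "w0 \<in> weyl \<Phi>" using assms by (simp add: longest_element_def)
  assume "\<not> positive (- w0 (\<alpha> j))"
  then have "positive (w0 (\<alpha> j))" using weyl_sign[OF w0] by blast
  then have "len w0 < len (w0 \<circ> s j)" by (rule len_ascent[OF w0])
  then show False using assms weyl_comp_simple[OF w0, of j] by (fastforce simp: longest_element_def)
qed

end

section \<open>The affine nil-Hecke algebra as a ring\<close>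

lemma poly_mapping_sum_single: "x = (\<Sum>w\<in>Poly_Mapping.keys x. Poly_Mapping.single w (Poly_Mapping.lookup x w))"
  by (rule poly_mapping_eqI) (auto simp: lookup_sum lookup_single when_def in_keys_iff)

lemma lookup_mult_closed:
  fixes x y :: "'a::monoid_add \<Rightarrow>\<^sub>0 'k::comm_ring_1" and S :: "'k set"
  assumes "0 \<in> S" "\<And>a b. a \<in> S \<Longrightarrow> b \<in> S \<Longrightarrow> a + b \<in> S" "\<And>a b. a \<in> S \<Longrightarrow> b \<in> S \<Longrightarrow> a * b \<in> S"
    and x: "\<And>w. Poly_Mapping.lookup x w \<in> S" and y: "\<And>w. Poly_Mapping.lookup y w \<in> S"
  shows "Poly_Mapping.lookup (x * y) w \<in> S"
proof -
  have sums: "sum f A \<in> S" if "\<And>a. a \<in> A \<Longrightarrow> f a \<in> S" for f :: "'a \<Rightarrow> 'k" and A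
    using that by (induction A rule: infinite_finite_induct) (auto simp: assms)
  have "x * y = (\<Sum>a\<in>Poly_Mapping.keys x. \<Sum>b\<in>Poly_Mapping.keys y.
      Poly_Mapping.single (a + b) (Poly_Mapping.lookup x a * Poly_Mapping.lookup y b))"
    by (subst poly_mapping_sum_single[of x], subst poly_mapping_sum_single[of y])
      (simp add: sum_product mult_single)
  then show ?thesis
    by (auto simp: lookup_sum lookup_single when_def assms intro!: sums)
qed

text \<open>Since 0 lies in \<open>S\<close>, the condition on coefficients may range over all words
  and not only over the support, which suits closure arguments better.\<close>

lemma carrier_free_algebra:
  assumes "0 \<in> S"
  shows "x \<in> carrier (free_algebra P S) \<longleftrightarrow>
    (\<forall>w. Poly_Mapping.lookup x w \<in> S) \<and> (\<forall>w\<in>Poly_Mapping.keys x. \<forall>\<mu>. gen_X \<mu> \<in> set w \<longrightarrow> \<mu> \<in> P)"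
  using assms by (auto simp: free_algebra_def) (metis in_keys_iff)

lemma single_carrier_free_algebra:
  "0 \<in> S \<Longrightarrow> c \<in> S \<Longrightarrow> \<forall>\<mu>. gen_X \<mu> \<in> set w \<longrightarrow> \<mu> \<in> P \<Longrightarrow>
    Poly_Mapping.single w c \<in> carrier (free_algebra P S)"
  by (simp add: carrier_free_algebra lookup_single when_def)

text \<open>The ring laws come from the convolution product on the type; only closure of the carrier
  needs an argument.\<close>

lemma ring_free_algebra:
  fixes S :: "'k::comm_ring_1 set"
  assumes S: "0 \<in> S" "1 \<in> S" "\<And>a. a \<in> S \<Longrightarrow> - a \<in> S"
    "\<And>a b. a \<in> S \<Longrightarrow> b \<in> S \<Longrightarrow> a + b \<in> S" "\<And>a b. a \<in> S \<Longrightarrow> b \<in> S \<Longrightarrow> a * b \<in> S"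
  shows "ring (free_algebra P S :: ('i, 'v, 'k) free_alg ring)"
proof -
  let ?F = "free_algebra P S :: ('i, 'v, 'k) free_alg ring"
  have ops: "monoid.mult ?F = (*)" "one ?F = 1" "zero ?F = 0" "add ?F = (+)"
    by (simp_all add: free_algebra_def)
  note mem = carrier_free_algebra[OF S(1)]
  have zero: "0 \<in> carrier ?F" using S by (simp add: mem)
  have one: "1 \<in> carrier ?F"
    using S by (simp add: mem lookup_one when_def zero_list_def)
  have uminus: "- x \<in> carrier ?F" if "x \<in> carrier ?F" for x
    using S that by (simp add: mem)
  have plus: "x + y \<in> carrier ?F" if "x \<in> carrier ?F" "y \<in> carrier ?F" for x y
    using S that keys_add[of x y] by (fastforce simp: mem lookup_add)
  have times: "x * y \<in> carrier ?F" if "x \<in> carrier ?F" "y \<in> carrier ?F" for x y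
  proof -
    have "Poly_Mapping.lookup (x * y) w \<in> S" for w
      using that S by (intro lookup_mult_closed) (auto simp: mem)
    moreover have "\<mu> \<in> P" if w: "w \<in> Poly_Mapping.keys (x * y)" "gen_X \<mu> \<in> set w" for w \<mu>
    proof -
      \<comment> \<open>Words in the support of a product are concatenations, so they bring in no
        new generators.\<close>
      obtain a b where "a \<in> Poly_Mapping.keys x" "b \<in> Poly_Mapping.keys y" "w = a @ b"
        using w(1) keys_mult[of x y] unfolding plus_list_def by blast
      then show ?thesis
        using w(2) \<open>x \<in> carrier ?F\<close> \<open>y \<in> carrier ?F\<close> by (auto simp: mem)
    qed
    ultimately show ?thesis by (simp add: mem)
  qed
  show ?thesis
  proof (rule ringI)
    show "abelian_group ?F"
      by (rule abelian_groupI)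
        (auto simp: ops zero plus add_ac intro!: bexI[OF _ uminus])
    show "monoid ?F"
      by (rule monoidI) (auto simp: ops one times mult.assoc)
  qed (auto simp: ops algebra_simps)
qed

section \<open>Fundamental weights, the weight lattice and the coefficient ring\<close>

locale weighted_root_system = based_root_system \<Phi> \<alpha>
  for \<Phi> :: "'v::real_vector set" and \<alpha> :: "'i::finite \<Rightarrow> 'v" +
  fixes \<omega> :: "'i \<Rightarrow> 'v"
  assumes fundamental_weights: "fundamental_weights \<Phi> \<alpha> \<omega>"
begin

abbreviation P :: "'v set" where "P \<equiv> weight_lattice \<omega>"
abbreviation R :: "('v \<Rightarrow>\<^sub>0 int) set" where "R \<equiv> coeff_ring \<omega>"
abbreviation H :: "('i, 'v) hecke_R ring" where "H \<equiv> hecke_R \<Phi> \<alpha> \<omega>"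
abbreviation F :: "('i, 'v, 'v \<Rightarrow>\<^sub>0 int) free_alg ring" where "F \<equiv> free_algebra P R"
abbreviation cls :: "('i, 'v, 'v \<Rightarrow>\<^sub>0 int) free_alg \<Rightarrow> ('i, 'v) hecke_R"
  where "cls \<equiv> hecke_class \<Phi> \<alpha> \<omega> R"
abbreviation T :: "'i \<Rightarrow> ('i, 'v) hecke_R" where "T \<equiv> T_elt \<Phi> \<alpha> \<omega>"
abbreviation X :: "'v \<Rightarrow> ('i, 'v) hecke_R" where "X \<equiv> X_elt \<Phi> \<alpha> \<omega>"
abbreviation sc :: "('v \<Rightarrow>\<^sub>0 int) \<Rightarrow> ('i, 'v) hecke_R" where "sc \<equiv> scalar \<Phi> \<alpha> \<omega>"

lemma coroot_weight: "coroot \<Phi> (\<alpha> j) (\<omega> i) = (if i = j then 1 else 0)"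
  using fundamental_weights by (simp add: fundamental_weights_def)

lemma coroot_weight_sum:
  "coroot \<Phi> (\<alpha> j) (\<Sum>i\<in>UNIV. c i *\<^sub>R \<omega> i) = c j"
  by (simp add: linear_coroot simple_root linear_sum linear_scale coroot_weight
      if_distrib[of "\<lambda>x. _ * x"] cong: if_cong)

text \<open>The coroots of the simple roots separate the fundamental weights, so these are
  independent, and being as many as the simple roots they span. Evaluating coroots identifies the
  coefficients.\<close>

lemma weight_expansion: "v = (\<Sum>i\<in>UNIV. coroot \<Phi> (\<alpha> i) v *\<^sub>R \<omega> i)"
proof -
  have inj: "inj \<omega>" by (rule injI) (metis coroot_weight zero_neq_one)
  have ind: "independent (range \<omega>)"
  proof (rule independent_if_scalars_zero)
    fix f :: "'v \<Rightarrow> real" and x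
    assume "(\<Sum>x\<in>range \<omega>. f x *\<^sub>R x) = 0" "x \<in> range \<omega>"
    then obtain j where "(\<Sum>i\<in>UNIV. f (\<omega> i) *\<^sub>R \<omega> i) = 0" "x = \<omega> j"
      by (auto simp: sum.reindex[OF inj])
    then show "f x = 0"
      using coroot_weight_sum[of j "\<lambda>i. f (\<omega> i)"] by (simp add: linear_0 linear_coroot simple_root)
  qed simp
  have alpha: "span (range \<alpha>) = UNIV" "inj \<alpha>" using simple_roots by (auto simp: simple_roots_def)
  have "v \<in> span (range \<omega>)"
  \<comment> \<open>A vector outside the span would yield an independent set larger than the
    spanning set of simple roots.\<close>
  proof (rule ccontr)
    assume v: "v \<notin> span (range \<omega>)"
    then have "independent (insert v (range \<omega>))" using ind by (simp add: independent_insert)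
    then have "card (insert v (range \<omega>)) \<le> card (range \<alpha>)"
      using alpha independent_span_bound[of "range \<alpha>" "insert v (range \<omega>)"] by simp
    moreover have "v \<notin> range \<omega>" using v span_base by blast
    ultimately show False using inj alpha by (simp add: card_image)
  qed
  then obtain c where "v = (\<Sum>x\<in>range \<omega>. c x *\<^sub>R x)" by (auto simp: span_finite)
  then have "v = (\<Sum>i\<in>UNIV. c (\<omega> i) *\<^sub>R \<omega> i)" by (simp add: sum.reindex[OF inj])
  then show ?thesis using coroot_weight_sum[of _ "\<lambda>i. c (\<omega> i)"] by simp
qed

text \<open>A test for weights by linear conditions, from which the closure properties of the
  lattice follow at once.\<close>

lemma weight_iff: "v \<in> P \<longleftrightarrow> (\<forall>j. coroot \<Phi> (\<alpha> j) v \<in> \<int>)"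
proof
  assume "v \<in> P"
  then show "\<forall>j. coroot \<Phi> (\<alpha> j) v \<in> \<int>"
    by (auto simp: weight_lattice_def coroot_weight_sum)
next
  assume int: "\<forall>j. coroot \<Phi> (\<alpha> j) v \<in> \<int>"
  have "v = (\<Sum>i\<in>UNIV. of_int \<lfloor>coroot \<Phi> (\<alpha> i) v\<rfloor> *\<^sub>R \<omega> i)"
    by (subst weight_expansion) (use int in simp)
  then show "v \<in> P" unfolding weight_lattice_def
    by (intro CollectI exI[of _ "\<lambda>i. \<lfloor>coroot \<Phi> (\<alpha> i) v\<rfloor>"]) simp
qed

lemma weight_zero: "0 \<in> P"
  and weight_add: "u \<in> P \<Longrightarrow> v \<in> P \<Longrightarrow> u + v \<in> P"
  and weight_uminus: "v \<in> P \<Longrightarrow> - v \<in> P"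
  and weight_diff: "u \<in> P \<Longrightarrow> v \<in> P \<Longrightarrow> u - v \<in> P"
  and weight_scale: "x \<in> \<int> \<Longrightarrow> v \<in> P \<Longrightarrow> x *\<^sub>R v \<in> P"
  and fundamental_weight: "\<omega> i \<in> P"
  by (simp_all add: weight_iff linear_0 linear_add linear_neg linear_diff linear_scale linear_coroot
      simple_root coroot_Ints coroot_weight)

lemma root_weight: "\<gamma> \<in> \<Phi> \<Longrightarrow> \<gamma> \<in> P"
  by (simp add: weight_iff simple_root coroot_Ints)

lemma weight_refl: "v \<in> P \<Longrightarrow> s j v \<in> P"
  unfolding root_refl_def
  by (intro weight_diff weight_scale) (auto simp: weight_iff simple_root coroot_Ints)

lemma weight_weyl: "w \<in> weyl \<Phi> \<Longrightarrow> v \<in> P \<Longrightarrow> w v \<in> P"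
proof -
  have "word js v \<in> P" if "v \<in> P" for js v
    using that by (induction js) (simp_all add: word_Cons weight_refl)
  then show "w \<in> weyl \<Phi> \<Longrightarrow> v \<in> P \<Longrightarrow> w v \<in> P" by (auto simp: weyl_eq_words)
qed

lemma coeff_zero: "0 \<in> R" and coeff_one: "1 \<in> R"
  and coeff_uminus: "a \<in> R \<Longrightarrow> - a \<in> R"
  and coeff_e_pow: "\<mu> \<in> P \<Longrightarrow> e_pow \<mu> \<in> R"
  by (simp_all add: coeff_ring_def weight_zero)

lemma coeff_add: "a \<in> R \<Longrightarrow> b \<in> R \<Longrightarrow> a + b \<in> R"
  using keys_add[of a b] by (auto simp: coeff_ring_def)

lemma coeff_mult: "a \<in> R \<Longrightarrow> b \<in> R \<Longrightarrow> a * b \<in> R"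
  unfolding coeff_ring_def using keys_mult[of a b] weight_add by blast

lemma coeff_of_int: "of_int k \<in> R"
proof -
  have "of_nat n \<in> R" for n by (induction n) (simp_all add: coeff_zero coeff_one coeff_add)
  then show ?thesis by (cases k rule: int_cases2) (simp_all add: coeff_uminus)
qed

section \<open>The presented algebra and its scalars\<close>

lemma ring_F: "ring F"
  by (rule ring_free_algebra) (simp_all add: coeff_zero coeff_one coeff_uminus coeff_add coeff_mult)

lemma F_ops: "monoid.mult F = (*)" "one F = 1" "zero F = 0" "add F = (+)"
  by (simp_all add: free_algebra_def)

lemma single_F: "c \<in> R \<Longrightarrow> \<forall>\<mu>. gen_X \<mu> \<in> set w \<longrightarrow> \<mu> \<in> P \<Longrightarrow> Poly_Mapping.single w c \<in> carrier F"
  by (rule single_carrier_free_algebra[OF coeff_zero])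

lemma wmon_F: "\<forall>\<mu>. gen_X \<mu> \<in> set w \<longrightarrow> \<mu> \<in> P \<Longrightarrow> wmon w \<in> carrier F"
  unfolding wmon_def by (rule single_F[OF coeff_one])

lemma F_uminus: "x \<in> carrier F \<Longrightarrow> - x \<in> carrier F"
  by (simp add: carrier_free_algebra[OF coeff_zero] coeff_uminus)

lemma F_add: "x \<in> carrier F \<Longrightarrow> y \<in> carrier F \<Longrightarrow> x + y \<in> carrier F"
  using abelian_groupE(1)[OF ring.is_abelian_group[OF ring_F]] by (simp add: F_ops)

lemma F_diff: "x \<in> carrier F \<Longrightarrow> y \<in> carrier F \<Longrightarrow> x - y \<in> carrier F"
  using F_add[of x "- y"] F_uminus[of y] by simp

lemma F_zero: "0 \<in> carrier F"
  by (simp add: carrier_free_algebra[OF coeff_zero] coeff_zero)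

lemma F_sum: "(\<And>a. a \<in> A \<Longrightarrow> f a \<in> carrier F) \<Longrightarrow> sum f A \<in> carrier F"
  by (induction A rule: infinite_finite_induct) (auto simp: F_zero F_add)

lemma F_minus: "x \<in> carrier F \<Longrightarrow> y \<in> carrier F \<Longrightarrow> x \<ominus>\<^bsub>F\<^esub> y = x - y"
proof -
  assume x: "x \<in> carrier F" and y: "y \<in> carrier F"
  interpret ring F by (rule ring_F)
  have "\<ominus>\<^bsub>F\<^esub> y = - y"
    by (rule minus_equality) (simp_all add: F_ops y F_uminus)
  then show ?thesis by (simp add: a_minus_def F_ops)
qed

lemma X_sum_in_F:
  assumes "Poly_Mapping.keys q \<subseteq> P"
  shows "X_sum (Poly_Mapping.map of_int q) \<in> carrier F"
  unfolding X_sum_def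
proof (rule F_sum)
  fix \<mu> assume "\<mu> \<in> Poly_Mapping.keys (Poly_Mapping.map of_int q :: 'v \<Rightarrow>\<^sub>0 ('v \<Rightarrow>\<^sub>0 int))"
  then have "Poly_Mapping.lookup q \<mu> \<noteq> 0" by (auto simp: in_keys_iff Poly_Mapping.map.rep_eq when_def)
  then have "\<mu> \<in> P" using assms by (auto simp: in_keys_iff)
  moreover have "Poly_Mapping.lookup (Poly_Mapping.map of_int q) \<mu> \<in> R"
    by (simp add: Poly_Mapping.map.rep_eq when_def coeff_of_int coeff_zero)
  ultimately show "Poly_Mapping.single [gen_X \<mu>] (Poly_Mapping.lookup (Poly_Mapping.map of_int q) \<mu>) \<in> carrier F"
    by (intro single_F) auto
qed

lemma relations_in_F: "hecke_relations \<Phi> \<alpha> \<omega> \<subseteq> carrier F"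
proof -
  have one: "1 \<in> carrier F" using monoid.one_closed[OF ring.is_monoid[OF ring_F]] by (simp add: F_ops)
  show ?thesis
    unfolding hecke_relations_def
    by (auto intro!: F_diff wmon_F one X_sum_in_F
        simp: braid_word_def weight_zero weight_add weight_refl split: if_splits)
qed

lemma ideal_hecke: "ideal (hecke_ideal \<Phi> \<alpha> \<omega> R) F"
  unfolding hecke_ideal_def by (rule ring.genideal_ideal[OF ring_F relations_in_F])

lemma cls_hom: "cls \<in> ring_hom F H"
  using ideal.rcos_ring_hom[OF ideal_hecke]
  unfolding hecke_R_def nil_hecke_def by (simp add: hecke_class_def[abs_def])

lemma cls_closed: "x \<in> carrier F \<Longrightarrow> cls x \<in> carrier H"
  and cls_add: "x \<in> carrier F \<Longrightarrow> y \<in> carrier F \<Longrightarrow> cls (x + y) = cls x \<oplus>\<^bsub>H\<^esub> cls y"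
  and cls_mult: "x \<in> carrier F \<Longrightarrow> y \<in> carrier F \<Longrightarrow> cls (x * y) = cls x \<otimes>\<^bsub>H\<^esub> cls y"
  and cls_one: "cls 1 = \<one>\<^bsub>H\<^esub>"
  using ring_hom_memE[OF cls_hom] by (simp_all add: F_ops)

lemma cls_relation:
  assumes "x - y \<in> hecke_relations \<Phi> \<alpha> \<omega>" "x \<in> carrier F" "y \<in> carrier F"
  shows "cls x = cls y"
proof -
  have "x \<ominus>\<^bsub>F\<^esub> y \<in> hecke_ideal \<Phi> \<alpha> \<omega> R"
    using ring.genideal_self[OF ring_F relations_in_F] assms
    by (auto simp: F_minus hecke_ideal_def)
  then show ?thesis
    using ring.quotient_eq_iff_same_a_r_cos[OF ring_F ideal_hecke assms(2,3)]
    by (simp add: hecke_class_def)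
qed

lemma wmon_mult: "wmon u * wmon w = wmon (u @ w)"
  by (simp add: wmon_def mult_single plus_list_def)

lemma single_wmon: "Poly_Mapping.single w c = Poly_Mapping.single [] c * wmon w"
  "Poly_Mapping.single w c = wmon w * Poly_Mapping.single [] c"
  by (simp_all add: wmon_def mult_single plus_list_def)

lemma ring_H: "ring H"
  using ideal.quotient_is_ring[OF ideal_hecke] by (simp add: hecke_R_def nil_hecke_def)

lemma T_closed: "T j \<in> carrier H"
  and X_closed: "\<mu> \<in> P \<Longrightarrow> X \<mu> \<in> carrier H"
  and scalar_closed: "c \<in> R \<Longrightarrow> sc c \<in> carrier H"
  by (auto simp: T_elt_def X_elt_def scalar_def intro!: cls_closed wmon_F single_F)

lemma scalar_add: "a \<in> R \<Longrightarrow> b \<in> R \<Longrightarrow> sc (a + b) = sc a \<oplus>\<^bsub>H\<^esub> sc b"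
  by (simp add: scalar_def single_add cls_add single_F)

lemma scalar_mult: "a \<in> R \<Longrightarrow> b \<in> R \<Longrightarrow> sc (a * b) = sc a \<otimes>\<^bsub>H\<^esub> sc b"
  by (simp add: scalar_def single_F mult_single plus_list_def flip: cls_mult)

lemma scalar_one: "sc 1 = \<one>\<^bsub>H\<^esub>"
  by (simp add: scalar_def flip: cls_one single_one zero_list_def)

lemma cls_zero: "cls 0 = \<zero>\<^bsub>H\<^esub>"
proof -
  interpret ring_hom_ring F H cls
    by (intro ring_hom_ringI2 ring_F cls_hom ideal.quotient_is_ring[OF ideal_hecke, folded nil_hecke_def hecke_R_def])
  show ?thesis using hom_zero by (simp add: F_ops)
qed

lemma scalar_zero: "sc 0 = \<zero>\<^bsub>H\<^esub>"
  by (simp add: scalar_def cls_zero)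

text \<open>A scalar sits on the empty word, which commutes with every word under concatenation.
  Comparing the two products shows that scalars commute with words.\<close>

lemma scalar_wmon:
  assumes "c \<in> R" "\<forall>\<mu>. gen_X \<mu> \<in> set w \<longrightarrow> \<mu> \<in> P"
  shows "cls (Poly_Mapping.single w c) = sc c \<otimes>\<^bsub>H\<^esub> cls (wmon w)"
    and "cls (Poly_Mapping.single w c) = cls (wmon w) \<otimes>\<^bsub>H\<^esub> sc c"
  using assms unfolding scalar_def
  by (simp_all add: single_F wmon_F single_wmon[of w c] flip: cls_mult)
    (simp flip: single_wmon)

lemma scalar_T: "c \<in> R \<Longrightarrow> T j \<otimes>\<^bsub>H\<^esub> sc c = sc c \<otimes>\<^bsub>H\<^esub> T j"
  using scalar_wmon[of c "[gen_T j]"] by (simp add: T_elt_def)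

lemma T_idem: "T j \<otimes>\<^bsub>H\<^esub> T j = T j"
proof -
  have "cls (wmon [gen_T j, gen_T j]) = cls (wmon [gen_T j])"
    by (rule cls_relation) (auto simp: hecke_relations_def intro!: wmon_F)
  then show ?thesis by (simp add: T_elt_def wmon_mult wmon_F flip: cls_mult)
qed

section \<open>Moving \<open>X\<close> past \<open>T\<close>\<close>

lemma X_T:
  assumes \<mu>: "\<mu> \<in> P" and q: "Poly_Mapping.keys q \<subseteq> P" "q * (1 - e_pow (- \<alpha> j)) = e_pow \<mu> - e_pow (s j \<mu>)"
  shows "X \<mu> \<otimes>\<^bsub>H\<^esub> T j = T j \<otimes>\<^bsub>H\<^esub> X (s j \<mu>) \<oplus>\<^bsub>H\<^esub> cls (X_sum (Poly_Mapping.map of_int q))"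
proof -
  have "cls (wmon [gen_X \<mu>, gen_T j]) =
      cls (wmon [gen_T j, gen_X (s j \<mu>)] + X_sum (Poly_Mapping.map of_int q))"
    by (rule cls_relation)
      (use assms in \<open>auto simp: hecke_relations_def diff_diff_eq[symmetric] weight_refl
          intro!: wmon_F F_add X_sum_in_F\<close>)
  then show ?thesis using assms
    by (simp add: T_elt_def X_elt_def wmon_mult wmon_F weight_refl X_sum_in_F
        flip: cls_mult cls_add)
qed

text \<open>A finite geometric series: each step of the induction adds the next exponential
  \<open>e_pow (\<mu> - real k *\<^sub>R \<alpha> j)\<close> to the quotient.\<close>

lemma divided_difference_nat:
  assumes "\<mu> \<in> P"
  shows "\<exists>q. Poly_Mapping.keys q \<subseteq> P \<and> q * (1 - e_pow (- \<alpha> j)) = e_pow \<mu> - e_pow (\<mu> - real k *\<^sub>R \<alpha> j)"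
proof (induction k)
  case 0
  show ?case by (intro exI[of _ 0]) simp
next
  case (Suc k)
  then obtain q where q: "Poly_Mapping.keys q \<subseteq> P"
    "q * (1 - e_pow (- \<alpha> j)) = e_pow \<mu> - e_pow (\<mu> - real k *\<^sub>R \<alpha> j)" by blast
  let ?\<nu> = "\<mu> - real k *\<^sub>R \<alpha> j"
  have "?\<nu> \<in> P" using assms by (intro weight_diff weight_scale) (auto intro: root_weight simple_root)
  then have keys: "Poly_Mapping.keys (q + e_pow ?\<nu>) \<subseteq> P"
    using q(1) keys_add[of q "e_pow ?\<nu>"] by auto
  have step: "?\<nu> + - \<alpha> j = \<mu> - real (Suc k) *\<^sub>R \<alpha> j"
    by (simp add: scaleR_add_left)
  have "e_pow ?\<nu> * (1 - e_pow (- \<alpha> j)) = e_pow ?\<nu> - e_pow (\<mu> - real (Suc k) *\<^sub>R \<alpha> j)"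
    unfolding right_diff_distrib mult_single step by simp
  then have "(q + e_pow ?\<nu>) * (1 - e_pow (- \<alpha> j)) = e_pow \<mu> - e_pow (\<mu> - real (Suc k) *\<^sub>R \<alpha> j)"
    unfolding distrib_right q(2) by simp
  with keys show ?case by blast
qed

lemma divided_difference:
  assumes "\<mu> \<in> P"
  shows "\<exists>q. Poly_Mapping.keys q \<subseteq> P \<and> q * (1 - e_pow (- \<alpha> j)) = e_pow \<mu> - e_pow (s j \<mu>)"
proof -
  have "coroot \<Phi> (\<alpha> j) \<mu> \<in> \<int>" using assms by (simp add: weight_iff)
  then obtain k :: int where k: "coroot \<Phi> (\<alpha> j) \<mu> = of_int k" by (auto elim: Ints_cases)
  show ?thesis
  proof (cases k rule: int_cases2)
    case (nonneg n)
    then show ?thesis using divided_difference_nat[OF assms, of j n] k by (simp add: root_refl_def)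
  next
    case (nonpos n)
    \<comment> \<open>For a nonpositive coroot value the roles of \<mu> and \<open>s j \<mu>\<close>
      are exchanged, and the quotient changes sign.\<close>
    obtain q where "Poly_Mapping.keys q \<subseteq> P"
      "q * (1 - e_pow (- \<alpha> j)) = e_pow (s j \<mu>) - e_pow (s j \<mu> - real n *\<^sub>R \<alpha> j)"
      using divided_difference_nat[OF weight_refl[OF assms], of j j n] by blast
    then show ?thesis
      using k nonpos by (intro exI[of _ "- q"]) (simp add: root_refl_def)
  qed
qed

text \<open>Here \<open>s j\<close> fixes \<mu>, so the numerator vanishes and 0 serves as the
  quotient.\<close>

lemma X_T_fixed:
  assumes "\<mu> \<in> P" "coroot \<Phi> (\<alpha> j) \<mu> = 0"
  shows "X \<mu> \<otimes>\<^bsub>H\<^esub> T j = T j \<otimes>\<^bsub>H\<^esub> X \<mu>"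
proof -
  interpret ring H by (rule ring_H)
  have "s j \<mu> = \<mu>" using assms by (simp add: root_refl_def)
  moreover have "X_sum (Poly_Mapping.map of_int (0 :: 'v \<Rightarrow>\<^sub>0 int)) = (0 :: ('i, 'v, 'v \<Rightarrow>\<^sub>0 int) free_alg)"
    by (simp add: X_sum_def Poly_Mapping.map.rep_eq when_def in_keys_iff)
  ultimately show ?thesis
    using X_T[of \<mu> 0 j] assms by (simp add: cls_zero T_closed X_closed)
qed

text \<open>Here \<open>s j \<mu>\<close> is \<open>\<mu> + \<alpha> j\<close>, so dividing by
  \<open>1 - e_pow (- \<alpha> j)\<close> leaves the single term
  \<open>- e_pow (s j \<mu>)\<close>.\<close>

lemma X_T_antidominant:
  assumes "\<mu> \<in> P" "coroot \<Phi> (\<alpha> j) \<mu> = -1"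
  shows "X \<mu> \<otimes>\<^bsub>H\<^esub> T j = T j \<otimes>\<^bsub>H\<^esub> X (s j \<mu>) \<oplus>\<^bsub>H\<^esub> \<ominus>\<^bsub>H\<^esub> X (s j \<mu>)"
proof -
  interpret ring H by (rule ring_H)
  let ?\<nu> = "s j \<mu>"
  have \<nu>: "?\<nu> \<in> P" and \<nu>': "?\<nu> + - \<alpha> j = \<mu>"
    using assms by (simp_all add: weight_refl) (simp add: root_refl_def)
  have map: "Poly_Mapping.map of_int (- e_pow ?\<nu>) = Poly_Mapping.single ?\<nu> (- 1 :: 'v \<Rightarrow>\<^sub>0 int)"
    by (rule poly_mapping_eqI) (simp add: Poly_Mapping.map.rep_eq lookup_single when_def)
  have "X_sum (Poly_Mapping.map of_int (- e_pow ?\<nu>)) = - (wmon [gen_X ?\<nu>] :: ('i, 'v, 'v \<Rightarrow>\<^sub>0 int) free_alg)"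
    unfolding map by (simp add: X_sum_def wmon_def single_uminus)
  moreover have "cls (- wmon [gen_X ?\<nu>]) = \<ominus>\<^bsub>H\<^esub> X ?\<nu>"
    unfolding X_elt_def using \<nu>
    by (intro minus_equality[symmetric])
      (auto simp: cls_zero wmon_F F_uminus cls_closed simp flip: cls_add)
  moreover have "- e_pow ?\<nu> * (1 - e_pow (- \<alpha> j)) = e_pow \<mu> - e_pow ?\<nu>"
    using \<nu>' by (simp add: right_diff_distrib mult_single)
  ultimately show ?thesis
    using X_T[of \<mu> "- e_pow ?\<nu>" j] assms \<nu> by simp
qed

end

section \<open>Coordinates with respect to the Schubert classes\<close>

sublocale KT_flag_variety \<subseteq> W?: weighted_root_system \<Phi> \<alpha> \<omega>
  by unfold_locales (use root_system simple_roots fundamental_weights in auto)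

sublocale KT_flag_variety \<subseteq> L: left_module H K
  by (rule left_module)

context KT_flag_variety
begin

section \<open>Coordinates as linear functions on the module\<close>

lemma w0_weyl: "w0 \<in> weyl \<Phi>"
  using longest_element by (simp add: longest_element_def)

definition lin_comb :: "(('v \<Rightarrow> 'v) \<Rightarrow> 'v \<Rightarrow>\<^sub>0 int) \<Rightarrow> 'm" where
  "lin_comb r = (\<Oplus>\<^bsub>K\<^esub>w\<in>weyl \<Phi>. sc (r w) \<odot>\<^bsub>K\<^esub> \<O> w)"

text \<open>For \<open>m\<close> in the carrier this is the unique extensional family given by
  \<open>basis\<close>. It is \<open>undefined\<close> outside the group, which is why statements
  about coordinates take their argument in \<open>weyl \<Phi>\<close>.\<close>

definition coord :: "'m \<Rightarrow> ('v \<Rightarrow> 'v) \<Rightarrow> 'v \<Rightarrow>\<^sub>0 int" where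
  "coord m = (THE r. r \<in> weyl \<Phi> \<rightarrow>\<^sub>E R \<and> m = lin_comb r)"

lemma term_closed: "c \<in> R \<Longrightarrow> w \<in> weyl \<Phi> \<Longrightarrow> sc c \<odot>\<^bsub>K\<^esub> \<O> w \<in> carrier K"
  by (simp add: L.smult_closed scalar_closed basis_closed)

lemma lin_comb_closed: "r \<in> weyl \<Phi> \<rightarrow> R \<Longrightarrow> lin_comb r \<in> carrier K"
  unfolding lin_comb_def by (intro L.M.finsum_closed) (auto intro: term_closed)

lemma coord_PiE: "m \<in> carrier K \<Longrightarrow> coord m \<in> weyl \<Phi> \<rightarrow>\<^sub>E R"
  and lin_comb_coord: "m \<in> carrier K \<Longrightarrow> lin_comb (coord m) = m"
  using theI'[OF basis[of m, folded lin_comb_def]] by (simp_all add: coord_def)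

lemma lin_comb_cong: "r \<in> weyl \<Phi> \<rightarrow> R \<Longrightarrow> (\<And>w. w \<in> weyl \<Phi> \<Longrightarrow> r w = r' w) \<Longrightarrow> lin_comb r = lin_comb r'"
  unfolding lin_comb_def by (intro L.M.finsum_cong') (auto intro!: term_closed simp: Pi_iff)

lemma coord_lin_comb:
  assumes "r \<in> weyl \<Phi> \<rightarrow> R" "u \<in> weyl \<Phi>"
  shows "coord (lin_comb r) u = r u"
proof -
  let ?r = "restrict r (weyl \<Phi>)"
  have r: "?r \<in> weyl \<Phi> \<rightarrow>\<^sub>E R" "lin_comb r = lin_comb ?r"
    using assms by (auto intro!: lin_comb_cong)
  note m = lin_comb_closed[OF assms(1)]
  have "coord (lin_comb r) = ?r"
    using basis[OF m, folded lin_comb_def] coord_PiE[OF m] lin_comb_coord[OF m] r by metis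
  then show ?thesis using assms by simp
qed

lemma coord_closed: "m \<in> carrier K \<Longrightarrow> u \<in> weyl \<Phi> \<Longrightarrow> coord m u \<in> R"
  using coord_PiE by blast

lemma coord_eqI:
  assumes "x \<in> carrier K" "y \<in> carrier K" "\<And>u. u \<in> weyl \<Phi> \<Longrightarrow> coord x u = coord y u"
  shows "x = y"
proof -
  have "lin_comb (coord x) = lin_comb (coord y)"
    using assms by (intro lin_comb_cong) (auto intro: coord_closed)
  then show ?thesis using assms by (simp add: lin_comb_coord)
qed

lemma coord_add:
  assumes x: "x \<in> carrier K" and y: "y \<in> carrier K" and u: "u \<in> weyl \<Phi>"
  shows "coord (x \<oplus>\<^bsub>K\<^esub> y) u = coord x u + coord y u"
proof -
  have "x \<oplus>\<^bsub>K\<^esub> y = lin_comb (coord x) \<oplus>\<^bsub>K\<^esub> lin_comb (coord y)"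
    using x y by (simp add: lin_comb_coord)
  also have "\<dots> = (\<Oplus>\<^bsub>K\<^esub>w\<in>weyl \<Phi>. sc (coord x w) \<odot>\<^bsub>K\<^esub> \<O> w \<oplus>\<^bsub>K\<^esub> sc (coord y w) \<odot>\<^bsub>K\<^esub> \<O> w)"
    unfolding lin_comb_def using x y
    by (intro L.M.finsum_addf[symmetric]) (auto intro!: term_closed coord_closed)
  also have "\<dots> = lin_comb (\<lambda>w. coord x w + coord y w)"
    unfolding lin_comb_def using x y
    by (intro L.M.finsum_cong')
      (auto simp: coord_closed scalar_add scalar_closed L.smult_l_distr basis_closed
        intro!: term_closed coord_closed coeff_add)
  finally show ?thesis
    using x y u by (simp add: coord_lin_comb coord_closed coeff_add Pi_iff)
qed

lemma coord_zero: "u \<in> weyl \<Phi> \<Longrightarrow> coord \<zero>\<^bsub>K\<^esub> u = 0"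
  using coord_add[of "\<zero>\<^bsub>K\<^esub>" "\<zero>\<^bsub>K\<^esub>" u] by simp

lemma coord_minus:
  assumes x: "x \<in> carrier K" and y: "y \<in> carrier K" and u: "u \<in> weyl \<Phi>"
  shows "coord (x \<ominus>\<^bsub>K\<^esub> y) u = coord x u - coord y u"
proof -
  have "coord (\<ominus>\<^bsub>K\<^esub> y) u + coord y u = 0"
    using y u by (simp add: L.M.l_neg coord_zero flip: coord_add)
  then show ?thesis
    using x y u by (simp add: a_minus_def coord_add eq_neg_iff_add_eq_0)
qed

text \<open>Not among the axioms of \<open>left_module\<close>; it follows from 0 + 0 = 0 by
  cancellation.\<close>

lemma zero_smult: "x \<in> carrier K \<Longrightarrow> \<zero>\<^bsub>H\<^esub> \<odot>\<^bsub>K\<^esub> x = \<zero>\<^bsub>K\<^esub>"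
  using L.smult_l_distr[of "\<zero>\<^bsub>H\<^esub>" "\<zero>\<^bsub>H\<^esub>" x] L.smult_closed[of "\<zero>\<^bsub>H\<^esub>" x]
  by (simp add: L.M.add.l_cancel_one')

lemma smult_zero: "a \<in> carrier H \<Longrightarrow> a \<odot>\<^bsub>K\<^esub> \<zero>\<^bsub>K\<^esub> = \<zero>\<^bsub>K\<^esub>"
  using L.smult_r_distr[of a "\<zero>\<^bsub>K\<^esub>" "\<zero>\<^bsub>K\<^esub>"] L.smult_closed[of a "\<zero>\<^bsub>K\<^esub>"]
  by (simp add: L.M.add.l_cancel_one')

lemma coord_term:
  assumes c: "c \<in> R" and w: "w \<in> weyl \<Phi>" and u: "u \<in> weyl \<Phi>"
  shows "coord (sc c \<odot>\<^bsub>K\<^esub> \<O> w) u = (if u = w then c else 0)"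
proof -
  let ?r = "\<lambda>u. if u = w then c else 0"
  have "lin_comb ?r = (\<Oplus>\<^bsub>K\<^esub>u\<in>weyl \<Phi>. if w = u then sc c \<odot>\<^bsub>K\<^esub> \<O> u else \<zero>\<^bsub>K\<^esub>)"
    unfolding lin_comb_def using c
    by (intro L.M.finsum_cong')
      (auto simp: scalar_zero zero_smult basis_closed intro!: term_closed)
  also have "\<dots> = sc c \<odot>\<^bsub>K\<^esub> \<O> w"
    using w c finite_weyl by (intro L.M.finsum_singleton) (auto intro: term_closed)
  finally show ?thesis
    using coord_lin_comb[of ?r u] c u by (auto simp: coeff_zero)
qed

lemma coord_basis:
  "w \<in> weyl \<Phi> \<Longrightarrow> u \<in> weyl \<Phi> \<Longrightarrow> coord (\<O> w) u = (if u = w then 1 else 0)"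
  using coord_term[OF coeff_one] by (simp add: scalar_one L.smult_one basis_closed)

text \<open>Additive assertions about the module reduce to scalar multiples of single Schubert
  classes.\<close>

lemma module_induct [consumes 1, case_names zero monomial add]:
  assumes "m \<in> carrier K"
    and zero: "Q \<zero>\<^bsub>K\<^esub>"
    and monomial: "\<And>c w. c \<in> R \<Longrightarrow> w \<in> weyl \<Phi> \<Longrightarrow> Q (sc c \<odot>\<^bsub>K\<^esub> \<O> w)"
    and add: "\<And>x y. x \<in> carrier K \<Longrightarrow> y \<in> carrier K \<Longrightarrow> Q x \<Longrightarrow> Q y \<Longrightarrow> Q (x \<oplus>\<^bsub>K\<^esub> y)"
  shows "Q m"
proof -
  have "Q (\<Oplus>\<^bsub>K\<^esub>w\<in>A. sc (coord m w) \<odot>\<^bsub>K\<^esub> \<O> w)" if "A \<subseteq> weyl \<Phi>" for A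
    using finite_subset[OF that finite_weyl] that
  proof (induction A rule: finite_induct)
    case empty
    then show ?case by (simp add: zero)
  next
    case (insert w A)
    have "(\<lambda>w. sc (coord m w) \<odot>\<^bsub>K\<^esub> \<O> w) \<in> insert w A \<rightarrow> carrier K"
      using insert.prems assms(1) by (auto intro!: term_closed coord_closed)
    then show ?case
      using insert assms(1) by (auto simp: L.M.finsum_insert intro!: add monomial coord_closed L.M.finsum_closed)
  qed
  from this[OF order_refl] show ?thesis
    using lin_comb_coord[OF assms(1)] by (simp add: lin_comb_def)
qed

lemma coord_scalar:
  assumes c: "c \<in> R" and m: "m \<in> carrier K" and u: "u \<in> weyl \<Phi>"
  shows "coord (sc c \<odot>\<^bsub>K\<^esub> m) u = c * coord m u"
  using m
proof (induction rule: module_induct)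
  case zero
  show ?case using c u by (simp add: smult_zero scalar_closed coord_zero)
next
  case (monomial a w)
  have "sc c \<odot>\<^bsub>K\<^esub> (sc a \<odot>\<^bsub>K\<^esub> \<O> w) = sc (c * a) \<odot>\<^bsub>K\<^esub> \<O> w"
    using c monomial by (simp add: scalar_mult L.smult_assoc scalar_closed basis_closed)
  then show ?case using c monomial u by (simp add: coord_term coeff_mult)
next
  case (add x y)
  then show ?case using c u
    by (simp add: L.smult_r_distr scalar_closed coord_add L.smult_closed distrib_left)
qed

section \<open>The operators \<open>T\<close> in coordinates\<close>

lemma T_basis:
  assumes w: "w \<in> weyl \<Phi>"
  shows "T j \<odot>\<^bsub>K\<^esub> \<O> w = (if positive (- w (\<alpha> j)) then \<O> w else \<O> (w \<circ> s j))"
  using T_action_up[OF w] T_action_down[OF w] bruhat_ascent[OF w, of j] bruhat_descent[OF w, of j]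
    weyl_sign[OF w, of j] by auto

lemma comp_simple_sign:
  assumes "w \<in> weyl \<Phi>"
  shows "positive (- (w \<circ> s j) (\<alpha> j)) \<longleftrightarrow> \<not> positive (- w (\<alpha> j))"
proof -
  have "- (w \<circ> s j) (\<alpha> j) = w (\<alpha> j)"
    using linear_weyl[OF assms] by (simp add: refl_self simple_root linear_neg)
  then show ?thesis
    using weyl_sign[OF assms, of j] not_positive_and_negative[of "w (\<alpha> j)"] by auto
qed

lemma comp_simple_eq_iff: "u \<circ> s j = w \<longleftrightarrow> u = w \<circ> s j"
  using comp_simple_simple by metis

lemma comp_simple_neq: "w \<in> weyl \<Phi> \<Longrightarrow> w \<circ> s j \<noteq> w"
  using comp_simple_sign by metis

text \<open>The classes at \<open>w\<close> and \<open>w \<circ> s j\<close> have the same image,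
  the class at the longer of the two. Coordinates therefore add up at the longer member of such a
  pair and vanish at the shorter one.\<close>

lemma coord_T:
  assumes m: "m \<in> carrier K" and u: "u \<in> weyl \<Phi>"
  shows "coord (T j \<odot>\<^bsub>K\<^esub> m) u =
    (if positive (- u (\<alpha> j)) then coord m u + coord m (u \<circ> s j) else 0)"
  using m
proof (induction rule: module_induct)
  case zero
  show ?case using u by (simp add: smult_zero T_closed coord_zero weyl_comp_simple)
next
  case (monomial c w)
  let ?v = "if positive (- w (\<alpha> j)) then w else w \<circ> s j"
  have "T j \<odot>\<^bsub>K\<^esub> (sc c \<odot>\<^bsub>K\<^esub> \<O> w) = sc c \<odot>\<^bsub>K\<^esub> (T j \<odot>\<^bsub>K\<^esub> \<O> w)"
    using monomial
    by (simp add: scalar_T T_closed scalar_closed basis_closed flip: L.smult_assoc)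
  also have "\<dots> = sc c \<odot>\<^bsub>K\<^esub> \<O> ?v" using monomial by (simp add: T_basis)
  finally have T: "coord (T j \<odot>\<^bsub>K\<^esub> (sc c \<odot>\<^bsub>K\<^esub> \<O> w)) u = (if u = ?v then c else 0)"
    using monomial u by (simp add: coord_term weyl_comp_simple)
  note c = coord_term[OF monomial u] coord_term[OF monomial weyl_comp_simple[OF u, of j]]
  moreover have "u = ?v \<longleftrightarrow> positive (- u (\<alpha> j)) \<and> (u = w \<or> u \<circ> s j = w)"
    using comp_simple_sign[OF u, of j] comp_simple_sign[of w j] monomial(2)
    by (auto simp: comp_simple_eq_iff)
  \<comment> \<open>At most one of the two summands is nonzero, so \<open>c\<close> is not counted
    twice.\<close>
  moreover have "\<not> (u = w \<and> u \<circ> s j = w)" using comp_simple_neq[OF u] by blast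
  ultimately show ?case unfolding T c
    by (cases "positive (- u (\<alpha> j))"; cases "u = w"; cases "u \<circ> s j = w")
      (simp_all only: if_True if_False simp_thms add_0_left add_0_right)
next
  case (add x y)
  then show ?case using u
    by (simp add: L.smult_r_distr T_closed coord_add L.smult_closed weyl_comp_simple del: o_apply)
qed

section \<open>Triangularity of \<open>X\<close> with respect to length\<close>

lemma coord_X_sum:
  assumes q: "Poly_Mapping.keys q \<subseteq> P" and w: "w \<in> weyl \<Phi>" and u: "u \<in> weyl \<Phi>"
    and vanish: "\<And>\<mu>. \<mu> \<in> P \<Longrightarrow> coord (X \<mu> \<odot>\<^bsub>K\<^esub> \<O> w) u = 0"
  shows "coord (cls (X_sum (Poly_Mapping.map of_int q)) \<odot>\<^bsub>K\<^esub> \<O> w) u = 0"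
proof -
  let ?q = "Poly_Mapping.map of_int q :: 'v \<Rightarrow>\<^sub>0 ('v \<Rightarrow>\<^sub>0 int)"
  let ?t = "\<lambda>\<mu>. Poly_Mapping.single [gen_X \<mu>] (Poly_Mapping.lookup ?q \<mu>) :: ('i, 'v, 'v \<Rightarrow>\<^sub>0 int) free_alg"
  have q': "Poly_Mapping.lookup ?q \<mu> \<in> R" for \<mu>
    by (simp add: Poly_Mapping.map.rep_eq when_def coeff_of_int coeff_zero)
  have keys: "Poly_Mapping.keys ?q \<subseteq> P"
    using q by (auto simp: in_keys_iff Poly_Mapping.map.rep_eq when_def subset_iff)
  have t: "?t \<mu> \<in> carrier F" if "\<mu> \<in> P" for \<mu>
    using that q' by (intro single_F) auto
  \<comment> \<open>The class is a combination of elements \<open>X \<mu>\<close> with coefficients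
    in \<open>R\<close>, added up weight by weight; the quotient itself never has to be
    computed.\<close>
  have "coord (cls (\<Sum>\<mu>\<in>A. ?t \<mu>) \<odot>\<^bsub>K\<^esub> \<O> w) u = 0" if "finite A" "A \<subseteq> P" for A
    using that
  proof (induction A rule: finite_induct)
    case empty
    then show ?case using w u by (simp add: cls_zero zero_smult basis_closed coord_zero)
  next
    case (insert \<mu> A)
    then have \<mu>: "\<mu> \<in> P" and A: "sum ?t A \<in> carrier F" by (auto intro!: F_sum t)
    have "cls (?t \<mu>) \<odot>\<^bsub>K\<^esub> \<O> w = sc (Poly_Mapping.lookup ?q \<mu>) \<odot>\<^bsub>K\<^esub> (X \<mu> \<odot>\<^bsub>K\<^esub> \<O> w)"
      using \<mu> w q' X_closed[OF \<mu>]
      by (simp add: scalar_wmon scalar_closed basis_closed X_elt_def L.smult_assoc)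
    then have "coord (cls (?t \<mu>) \<odot>\<^bsub>K\<^esub> \<O> w) u = 0"
      using \<mu> w u q' by (simp add: coord_scalar L.smult_closed X_closed basis_closed vanish)
    then show ?case
      using insert \<mu> A w u
      by (simp add: cls_add t L.smult_l_distr cls_closed basis_closed coord_add L.smult_closed)
  qed
  from this[OF _ keys] show ?thesis by (simp add: X_sum_def)
qed

text \<open>Induction on the length of \<open>w\<close>. For a descent \<open>j\<close>, the class
  at \<open>w\<close> is \<open>T j\<close> applied to the class at the shorter
  \<open>w \<circ> s j\<close>, and moving \<open>X\<close> past \<open>T j\<close> leaves two
  actions on that shorter class. Admitting every \<open>u\<close> at least as long as
  \<open>w\<close> makes the hypothesis available at both \<open>u\<close> and
  \<open>u \<circ> s j\<close>.\<close>

lemma coord_X_basis: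
  assumes "w \<in> weyl \<Phi>" "\<mu> \<in> P" "u \<in> weyl \<Phi>" "len w \<le> len u"
  shows "coord (X \<mu> \<odot>\<^bsub>K\<^esub> \<O> w) u = (if u = w then e_pow (w \<mu>) else 0)"
  using assms
proof (induction "len w" arbitrary: w \<mu> u rule: less_induct)
  case less
  note w = \<open>w \<in> weyl \<Phi>\<close> and u = \<open>u \<in> weyl \<Phi>\<close> and \<mu> = \<open>\<mu> \<in> P\<close>
  show ?case
  proof (cases "w = id")
    case True
    then show ?thesis
      using X_action[OF \<mu>] coord_term[OF coeff_e_pow[OF \<mu>] w u] by simp
  next
    case False
    then obtain j where neg: "positive (- w (\<alpha> j))" and lt: "len (w \<circ> s j) < len w"
      using weyl_neq_id_descent[OF w] by blast
    define v where "v = w \<circ> s j"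
    have v: "v \<in> weyl \<Phi>" and vw: "v \<circ> s j = w" and lv: "len v < len w"
      using weyl_comp_simple[OF w] lt by (simp_all add: v_def comp_simple_simple)
    have "\<not> positive (- v (\<alpha> j))" using comp_simple_sign[OF w] neg by (simp add: v_def)
    then have Tv: "T j \<odot>\<^bsub>K\<^esub> \<O> v = \<O> w" using T_basis[OF v] vw by simp
    obtain q where q: "Poly_Mapping.keys q \<subseteq> P" "q * (1 - e_pow (- \<alpha> j)) = e_pow \<mu> - e_pow (s j \<mu>)"
      using divided_difference[OF \<mu>] by blast
    let ?y = "X (s j \<mu>) \<odot>\<^bsub>K\<^esub> \<O> v" and ?z = "cls (X_sum (Poly_Mapping.map of_int q)) \<odot>\<^bsub>K\<^esub> \<O> v"
    note cl = T_closed X_closed[OF \<mu>] X_closed[OF weight_refl[OF \<mu>]]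
      cls_closed[OF X_sum_in_F[OF q(1)]] basis_closed[OF v] L.smult_closed
    have "X \<mu> \<odot>\<^bsub>K\<^esub> \<O> w = (X \<mu> \<otimes>\<^bsub>H\<^esub> T j) \<odot>\<^bsub>K\<^esub> \<O> v"
      by (simp add: Tv L.smult_assoc cl)
    also have "\<dots> = T j \<odot>\<^bsub>K\<^esub> ?y \<oplus>\<^bsub>K\<^esub> ?z"
      unfolding X_T[OF \<mu> q] by (simp add: L.smult_l_distr L.smult_assoc cl)
    finally have "coord (X \<mu> \<odot>\<^bsub>K\<^esub> \<O> w) u = coord (T j \<odot>\<^bsub>K\<^esub> ?y) u + coord ?z u"
      using u by (simp add: coord_add cl)
    \<comment> \<open>\<open>u\<close> is longer than \<open>v\<close>, so no \<open>X\<close>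
      acting on the class at \<open>v\<close> contributes at \<open>u\<close>.\<close>
    also have "coord ?z u = 0"
      using less.hyps[OF lv v _ u] less.prems(4) lv by (intro coord_X_sum q v u) auto
    also have "coord (T j \<odot>\<^bsub>K\<^esub> ?y) u = (if u = w then e_pow (w \<mu>) else 0)"
    proof (cases "positive (- u (\<alpha> j))")
      case True
      have us: "u \<circ> s j \<in> weyl \<Phi>" by (rule weyl_comp_simple[OF u])
      \<comment> \<open>Passing to \<open>u \<circ> s j\<close> loses at most one unit of length, so
        it is still at least as long as \<open>v\<close>.\<close>
      have "len u \<le> Suc (len (u \<circ> s j))"
        using len_comp_simple[OF us, of j] by (simp only: comp_simple_simple)
      then have "coord ?y (u \<circ> s j) = (if u \<circ> s j = v then e_pow (v (s j \<mu>)) else 0)"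
        using lv less.prems(4) by (intro less.hyps[OF lv v weight_refl[OF \<mu>] us]) linarith
      moreover have "coord ?y u = 0"
        using less.hyps[OF lv v weight_refl[OF \<mu>] u] lv less.prems(4) by auto
      moreover have "v (s j \<mu>) = w \<mu>" using fun_cong[OF vw, of \<mu>] by simp
      moreover have "u \<circ> s j = v \<longleftrightarrow> u = w" using vw comp_simple_eq_iff[of u j v] by auto
      ultimately show ?thesis using True u by (simp add: coord_T cl)
    next
      \<comment> \<open>The image of \<open>T j\<close> has coordinate zero at an ascent, and
        \<open>u = w\<close> is impossible because \<open>w\<close> has a descent at
        \<open>j\<close>.\<close>
      case False
      then show ?thesis using neg u by (auto simp: coord_T cl)
    qed
    finally show ?thesis by simp
  qed
qed

text \<open>The identities for the \<open>T j\<close> leave one free scalar, placed at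
  \<open>w0\<close> and \<open>w0 \<circ> s i\<close> with opposite signs; triangularity at
  \<open>w0\<close> fixes it.\<close>

lemma coord_X_fundamental:
  assumes u: "u \<in> weyl \<Phi>"
  shows "coord (X (- \<omega> i) \<odot>\<^bsub>K\<^esub> \<O> w0) u =
    (if u = w0 then e_pow (- w0 (\<omega> i)) else if u = w0 \<circ> s i then - e_pow (- w0 (\<omega> i)) else 0)"
proof -
  let ?m = "X (- \<omega> i) \<odot>\<^bsub>K\<^esub> \<O> w0"
  note desc = longest_element_descent[OF longest_element]
  have wt: "- \<omega> i \<in> P" by (intro weight_uminus fundamental_weight)
  have co: "coroot \<Phi> (\<alpha> j) (- \<omega> i) = (if i = j then -1 else 0)" for j
    by (simp add: linear_neg linear_coroot simple_root coroot_weight)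
  note cl = T_closed X_closed[OF wt] X_closed[OF weight_refl[OF wt]] basis_closed
    w0_weyl weyl_comp_simple L.smult_closed
  have fixed: "T j \<odot>\<^bsub>K\<^esub> ?m = ?m" if "j \<noteq> i" for j
  proof -
    have "T j \<odot>\<^bsub>K\<^esub> ?m = X (- \<omega> i) \<odot>\<^bsub>K\<^esub> (T j \<odot>\<^bsub>K\<^esub> \<O> w0)"
      using X_T_fixed[OF wt] co that by (simp add: cl flip: L.smult_assoc)
    then show ?thesis using T_basis[OF w0_weyl] desc by simp
  qed
  have killed: "T i \<odot>\<^bsub>K\<^esub> ?m = \<zero>\<^bsub>K\<^esub>"
  proof -
    let ?x = "X (s i (- \<omega> i))"
    \<comment> \<open>\<open>T i\<close> fixes the class at \<open>w0\<close>, so a factor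
      \<open>T i\<close> may be inserted for \<open>X\<close> to be moved past.\<close>
    have "T i \<odot>\<^bsub>K\<^esub> ?m = (T i \<otimes>\<^bsub>H\<^esub> (X (- \<omega> i) \<otimes>\<^bsub>H\<^esub> T i)) \<odot>\<^bsub>K\<^esub> \<O> w0"
      using T_basis[OF w0_weyl, of i] desc by (simp add: L.smult_assoc cl)
    also have "T i \<otimes>\<^bsub>H\<^esub> (X (- \<omega> i) \<otimes>\<^bsub>H\<^esub> T i) = T i \<otimes>\<^bsub>H\<^esub> (T i \<otimes>\<^bsub>H\<^esub> ?x \<oplus>\<^bsub>H\<^esub> \<ominus>\<^bsub>H\<^esub> ?x)"
      using X_T_antidominant[OF wt] co by simp
    \<comment> \<open>The product is T(T - 1)X, which idempotence annihilates.\<close>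
    also have "\<dots> = \<zero>\<^bsub>H\<^esub>"
      by (simp add: L.A.r_distr L.A.r_minus L.A.r_neg T_idem cl flip: L.A.m_assoc)
    finally show ?thesis by (simp add: zero_smult cl)
  qed
  \<comment> \<open>An element fixed by \<open>T j\<close> has no coordinate at an element with an
    ascent at \<open>j\<close>.\<close>
  have support: "positive (- u (\<alpha> j))" if "coord ?m u \<noteq> 0" "j \<noteq> i" "u \<in> weyl \<Phi>" for u j
    using coord_T[of ?m u j] fixed[OF that(2)] that by (auto simp: cl split: if_splits)
  \<comment> \<open>Since \<open>T i\<close> kills \<open>?m\<close>, the two coordinates of each
    pair sum to zero.\<close>
  have anti: "coord ?m (u \<circ> s i) = - coord ?m u" if u: "u \<in> weyl \<Phi>" for u
  proof (cases "positive (- u (\<alpha> i))")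
    case True
    then show ?thesis using coord_T[of ?m u i] killed u
      by (simp add: cl coord_zero add_eq_0_iff2)
  next
    case False
    then have "positive (- (u \<circ> s i) (\<alpha> i))" using comp_simple_sign[OF u] by blast
    then have "coord ?m (u \<circ> s i) + coord ?m (u \<circ> s i \<circ> s i) = 0"
      using coord_T[of ?m "u \<circ> s i" i] killed u by (simp add: cl coord_zero)
    then show ?thesis by (simp only: comp_simple_simple eq_neg_iff_add_eq_0)
  qed
  \<comment> \<open>A nonzero coordinate supplies the descents at all indices other than
    \<open>i\<close>, and the last hypothesis the one at \<open>i\<close>.\<close>
  have top: "u = w0" if "coord ?m u \<noteq> 0" "u \<in> weyl \<Phi>" "positive (- u (\<alpha> i))" for u
    by (rule all_descents_unique[OF that(2) _ w0_weyl desc]) (metis that support)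
  have lead: "coord ?m w0 = e_pow (- w0 (\<omega> i))"
    using coord_X_basis[OF w0_weyl wt w0_weyl] linear_weyl[OF w0_weyl] by (simp add: linear_neg)
  show ?thesis
  proof (cases "positive (- u (\<alpha> i))")
    case True
    then have "u \<noteq> w0 \<circ> s i" using comp_simple_sign[OF w0_weyl, of i] desc[of i] by auto
    then show ?thesis using top[OF _ u True] lead by auto
  next
    case False
    then have pos: "positive (- (u \<circ> s i) (\<alpha> i))" using comp_simple_sign[OF u] by blast
    have "u \<noteq> w0" using False desc by auto
    moreover have "u = w0 \<circ> s i" if "coord ?m u \<noteq> 0"
    proof -
      have "u \<circ> s i = w0"
        using that anti[OF u] by (intro top[OF _ weyl_comp_simple[OF u] pos]) (simp del: o_apply)
      then show ?thesis by (rule comp_simple_eq_iff[THEN iffD1])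
    qed
    ultimately show ?thesis
      using anti[OF w0_weyl] lead by metis
  qed
qed

text \<open>Multiplying by \<open>e_pow (w0 (\<omega> i))\<close> turns the coordinates at
  \<open>w0\<close> and \<open>w0 \<circ> s i\<close> into 1 and -1, so subtracting from the
  identity leaves exactly the class at \<open>w0 \<circ> s i\<close>.\<close>

lemma schubert_divisor:
  "\<O> (w0 \<circ> s i) =
    \<one>\<^bsub>K\<^esub> \<ominus>\<^bsub>K\<^esub> sc (e_pow (w0 (\<omega> i))) \<odot>\<^bsub>K\<^esub> X_class \<Phi> \<alpha> \<omega> w0 K \<O> (- \<omega> i)"
proof -
  have e: "e_pow (w0 (\<omega> i)) \<in> R"
    by (rule coeff_e_pow[OF weight_weyl[OF w0_weyl fundamental_weight]])
  have m: "X (- \<omega> i) \<odot>\<^bsub>K\<^esub> \<O> w0 \<in> carrier K"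
    by (intro L.smult_closed X_closed weight_uminus fundamental_weight basis_closed w0_weyl)
  have ne: "w0 \<circ> s i \<noteq> w0" by (rule comp_simple_neq[OF w0_weyl])
  have w0s: "w0 \<circ> s i \<in> weyl \<Phi>" by (rule weyl_comp_simple[OF w0_weyl])
  show ?thesis
    unfolding X_class_def one_eq
  proof (rule coord_eqI)
    fix u assume u: "u \<in> weyl \<Phi>"
    show "coord (\<O> (w0 \<circ> s i)) u =
      coord (\<O> w0 \<ominus>\<^bsub>K\<^esub> sc (e_pow (w0 (\<omega> i))) \<odot>\<^bsub>K\<^esub> (X (- \<omega> i) \<odot>\<^bsub>K\<^esub> \<O> w0)) u"
      using ne by (simp add: coord_minus coord_basis coord_scalar coord_X_fundamental u w0s w0_weyl e m
          basis_closed L.smult_closed scalar_closed mult_single single_one)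
  qed (simp_all add: basis_closed w0s w0_weyl L.smult_closed scalar_closed e m L.M.minus_closed)
qed

end

theorem proposition3p10:
  fixes \<Phi> :: "'v::real_vector set"
    and \<alpha> \<omega> :: "'i::finite \<Rightarrow> 'v"
    and w0 :: "'v \<Rightarrow> 'v"
    and K :: "(('i, 'v) hecke_R, 'm) module"
    and \<O> :: "('v \<Rightarrow> 'v) \<Rightarrow> 'm"
    and i :: 'i
  assumes "KT_flag_variety \<Phi> \<alpha> \<omega> w0 K \<O>"
  shows "\<O> (w0 \<circ> root_refl \<Phi> (\<alpha> i)) =
    \<one>\<^bsub>K\<^esub> \<ominus>\<^bsub>K\<^esub> scalar \<Phi> \<alpha> \<omega> (e_pow (w0 (\<omega> i))) \<odot>\<^bsub>K\<^esub> X_class \<Phi> \<alpha> \<omega> w0 K \<O> (- \<omega> i)"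
  using assms by (rule KT_flag_variety.schubert_divisor)

end
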